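(* Let $R$ be a strong preparation map. For every $1\leq i\leq k_0$ and every decorated tree $\tau=X^{k}\zeta_{l}\prod_{j=1}^n\mathcal{I}_{a_j}(\tau_j)$ with $a_j=(\mathfrak{t}^+_{l_j},p_j)\in\mathfrak{T}^+\times\mathbb{N}^{d+1}$, one has $$ F_i(R^*\tau)=\Big(\partial^kD_{a_1}\cdots D_{a_n}F_i(R^*\zeta_l)\Big)\,\prod_{j=1}^{n}F_{l_j}(\tau_j). $$
   Context: **Decorated trees.** Fix integers $d,n_0,k_0\ge 1$, a finite set of noise types $\mathfrak{T}^-=\{\mathfrak{t}^-_1,\dots,\mathfrak{t}^-_{n_0}\}$ and a finite set of operator types $\mathfrak{T}^+=\{\mathfrak{t}_1^+,\dots,\mathfrak{t}_{k_0}^+\}$. Decorated trees are non-planar rooted trees with a decoration $\mathfrak{n}_v\in\mathbb{N}^{d+1}$ at each node $v$, each edge being decorated by an element $(\mathfrak{t},p)$ of $\mathfrak{T}^+\times\mathbb{N}^{d+1}$, and with at most one noise attached to each node. A noise of type $\mathfrak{t}_l^-$ attached to a node (an edge of noise type leading directly to a leaf) is denoted by the symbol $\zeta_l$, $1\le l\le n_0$; the leaf of a noise edge is not counted as a node of the tree. By convention $\zeta_0=\mathbf{1}$ (no noise). Write $N_\tau$ for the node set of $\tau$. For $a\in\mathfrak{T}^+\times\mathbb{N}^{d+1}$, $\mathcal{I}_a(\tau)$ is the tree obtained by grafting $\tau$ onto a new undecorated root via an edge decorated by $a$; $X^k$ is the single node decorated by $k$; $X^0=\mathbf{1}$. Every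 decorated tree has a unique decomposition (up to reordering) $\tau=X^k\zeta_l\prod_{j=1}^n\mathcal{I}_{a_j}(\tau_j)$ with $0\le l\le n_0$, $a_j\in\mathfrak{T}^+\times\mathbb{N}^{d+1}$, the product being the tree product (identification of roots). $T$ is the real linear span of all decorated trees. **Inner product.** Grouping equal factors, $\tau=X^k\zeta_l\prod_{j=1}^m\mathcal{I}_{a_j}(\tau_j)^{\beta_j}$ with $(a_i,\tau_i)\ne(a_j,\tau_j)$ for $i\neq j$, set inductively $S(\tau)=k!\prod_{j=1}^mS(\tau_j)^{\beta_j}\beta_j!$. The inner product on $T$ is $\langle\sigma,\tau\rangle:=S(\tau)\mathbf{1}_{\sigma=\tau}$ on trees, and $\langle\sigma_1\otimes\sigma_2,\tau_1\otimes\tau_2\rangle:=\langle\sigma_1,\tau_1\rangle\langle\sigma_2,\tau_2\rangle$. The adjoint $R^*:T\to T$ of a linear map $R:T\to T$ is characterised by $\langle R^*\sigma,\tau\rangle=\langle\sigma,R\tau\rangle$ for all $\sigma,\tau\in T$ (it is assumed to exist as a map from $T$ to $T$). **Degree and $T_+$.** Fix a scaling $\mathfrak{s}\in\mathbb{N}^{d+1}$ with positive entries and a map $|\cdot|_{\mathfrak{s}}:\mathfrak{T}^-\cup\mathfrak{T}^+\to\mathbb{R}$ negative on $\mathfrak{T}^-$ and positive on $\mathfrak{T}^+$; set $|p|_{\mathfrak s}=\sum_i\mathfrak{s}_ip_i$. The degree $\deg(\tau)$ is the sum of $|\mathfrak{n}_v|_{\mathfrak{s}}$ over nodes $v$, of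 $|\mathfrak{t}|_{\mathfrak s}-|p|_{\mathfrak s}$ over edges decorated by $(\mathfrak{t},p)$, and of $|\mathfrak{t}_l^-|_{\mathfrak s}$ over the noises $\zeta_l$ ($l\ge1$) of $\tau$. $|\tau|$ is the number of noise symbols $\zeta_l$, $l\ge1$, in $\tau$. $T_+$ is the linear span of trees $X^k\prod_{i=1}^n\mathcal{I}_{a_i}(\tau_i)$ with $\deg(\mathcal{I}_{a_i}(\tau_i))>0$ for all $i$. **Product $\star$.** For $a=(\mathfrak{t},p)$ and $m\in\mathbb{N}^{d+1}$ write $a\pm m=(\mathfrak{t},p\pm m)$; a tree having an edge decoration $(\mathfrak{t},p-m)$ with $p-m\notin\mathbb{N}^{d+1}$ is set to $0$. For decorated trees $\sigma_1,\dots,\sigma_n,\tau$ and $a_i\in\mathfrak{T}^+\times\mathbb{N}^{d+1}$, $$\prod_{i=1}^n\mathcal{I}_{a_i}(\sigma_i)\curvearrowright\tau:=\sum_{v_1,\dots,v_n\in N_\tau}\ \sum_{m_1,\dots,m_n\in\mathbb{N}^{d+1}}\ \prod_{v\in N_\tau}\frac{\mathfrak{n}_v!}{\big(\mathfrak{n}_v-\sum_{i:v_i=v}m_i\big)!\prod_{i:v_i=v}m_i!}\ \tau_{v,m},$$ where $\tau_{v,m}$ is obtained from $\tau$ by replacing the decoration $\mathfrak{n}_v$ of each node $v$ of $\tau$ by $\mathfrak{n}_v-\sum_{i:v_i=v}m_i$ and grafting each $\sigma_i$ onto the node $v_i$ with an edge decorated by $a_i-m_i$ (terms with $\sum_{i:v_i=v}m_i\not\le\mathfrak{n}_v$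 for some $v$ are zero). For $B\subset N_\tau$, $\uparrow_B^k:=\prod_{r=1}^{d+1}\big(\sum_{v\in B}\uparrow_v^{e_r}\big)^{k_r}$, where $\uparrow_v^{e_r}$ adds $e_r$ to the decoration at $v$ and $(e_r)$ is the canonical basis of $\mathbb{N}^{d+1}$. For $\sigma=X^k\prod_i\mathcal{I}_{a_i}(\sigma_i)$ with $a_i\in\mathfrak{T}^+\times\mathbb{N}^{d+1}$, $$\sigma\star\tau:=\ \uparrow^k_{N_\tau}\Big(\prod_i\mathcal{I}_{a_i}(\sigma_i)\curvearrowright\tau\Big),$$ where $\uparrow^k_{N_\tau}$ acts only on the nodes coming from $\tau$; extended bilinearly. $\Delta:T\to T\otimes T_+$ is the linear map characterised by $\langle\sigma\star\tau,\mu\rangle=\langle\tau\otimes\sigma,\Delta\mu\rangle$ for all $\sigma\in T_+$, $\tau,\mu\in T$. **Strong preparation maps.** A preparation map is a linear map $R:T\to T$ such that (i) for each decorated tree $\tau$ there are finitely many trees $\tau_i$ and constants $\lambda_i$ with $R\tau=\tau+\sum_i\lambda_i\tau_i$, $\deg(\tau_i)\ge\deg(\tau)$ and $|\tau_i|<|\tau|$; (ii) $(R\otimes\mathrm{id})\Delta=\Delta R$. It is strong if moreover $R^*(\sigma\star\tau)=\sigma\star(R^*\tau)$ for all $\tau\in T$ and all $\sigma=X^k\prod_i\mathcal{I}_{a_i}(\sigma_i)\in T$ with $a_i\in\mathfrak{T}^+\times\mathbb{N}^{d+1}$ (with no condition on degrees). **The functions $F_i$.** Let $(Z_a)$ be variables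 indexed by $a\in\mathfrak{T}^+\times\mathbb{N}^{d+1}$, and let $(F_i^l)_{1\le i\le k_0,\,0\le l\le n_0}$ be given smooth functions, each of finitely many of these variables. $D_a$ is the partial derivative in $Z_a$; $\partial_r:=\sum_a Z_{a+e_r}D_a$ for $1\le r\le d+1$ and $\partial^k:=\partial_1^{k_1}\cdots\partial_{d+1}^{k_{d+1}}$. (If $Z_{(\mathfrak{t}_j^+,p)}$ and $F_j^l$ are vector-valued, in $\mathbb{R}^{d_j}$, products of derivatives with such quantities are understood as evaluation of multilinear maps.) Define inductively, for $\tau=X^k\zeta_l\prod_{j=1}^n\mathcal{I}_{a_j}(\tau_j)$ with $a_j=(\mathfrak{t}^+_{l_j},p_j)$, $$F_i(\zeta_l):=F_i^l,\qquad F_i(\tau):=\Big(\partial^kD_{a_1}\cdots D_{a_n}F_i(\zeta_l)\Big)\prod_{j=1}^nF_{l_j}(\tau_j),$$ and extend $F_i$ linearly to $T$. *)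

theory Defs
  imports "HOL-Analysis.Analysis" "HOL-Library.Poly_Mapping"
begin

section \<open>Finite formal linear combinations\<close>

instantiation poly_mapping :: (type, real_vector) real_vector
begin

lift_definition scaleR_poly_mapping :: "real \<Rightarrow> ('a \<Rightarrow>\<^sub>0 'b) \<Rightarrow> 'a \<Rightarrow>\<^sub>0 'b"
  is "\<lambda>r f x. r *\<^sub>R f x"
  by (rule finite_subset[rotated]) auto

instance
  by standard (transfer; simp add: fun_eq_iff algebra_simps)+

end

abbreviation basis :: "'a \<Rightarrow> 'a \<Rightarrow>\<^sub>0 real"
  where "basis x \<equiv> Poly_Mapping.single x 1"

definition lin_ext :: "('a \<Rightarrow> 'b::real_vector) \<Rightarrow> ('a \<Rightarrow>\<^sub>0 real) \<Rightarrow> 'b"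
  where "lin_ext f x = (\<Sum>a\<in>Poly_Mapping.keys x. Poly_Mapping.lookup x a *\<^sub>R f a)"

text \<open>The tensor product of the spaces with bases \<open>'a\<close> and \<open>'b\<close> is the space with
  basis \<open>'a \<times> 'b\<close>.\<close>

definition tensor :: "('a \<Rightarrow>\<^sub>0 real) \<Rightarrow> ('b \<Rightarrow>\<^sub>0 real) \<Rightarrow> ('a \<times> 'b) \<Rightarrow>\<^sub>0 real"
  where "tensor x y = lin_ext (\<lambda>a. lin_ext (\<lambda>b. basis (a, b)) y) x"

definition tensor_map ::
  "(('a \<Rightarrow>\<^sub>0 real) \<Rightarrow> 'c \<Rightarrow>\<^sub>0 real) \<Rightarrow> (('b \<Rightarrow>\<^sub>0 real) \<Rightarrow> 'd \<Rightarrow>\<^sub>0 real)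
    \<Rightarrow> (('a \<times> 'b) \<Rightarrow>\<^sub>0 real) \<Rightarrow> ('c \<times> 'd) \<Rightarrow>\<^sub>0 real"
  where "tensor_map P Q = lin_ext (\<lambda>(a, b). tensor (P (basis a)) (Q (basis b)))"


section \<open>Decorated trees\<close>

text \<open>The type \<open>'i\<close> indexes the \<open>d + 1\<close> coordinates, \<open>'n\<close> is the set of noise types
  and \<open>'o\<close> the set of operator types. In \<open>Node k l C\<close> the noise \<open>l\<close> is \<open>None\<close> for
  \<open>\<zeta>\<^sub>0 = \<one>\<close>, and \<open>C\<close> is the multiset of the pairs \<open>(a\<^sub>j, \<tau>\<^sub>j)\<close>, so that
  \<open>Node k l C\<close> is \<open>X\<^sup>k \<zeta>\<^sub>l \<Prod>\<^sub>j \<I>\<^bsub>a\<^sub>j\<^esub>(\<tau>\<^sub>j)\<close>.\<close>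

type_synonym ('i, 'o) edge = "'o \<times> (nat, 'i) vec"

datatype ('i::finite, 'n, 'o) dtree =
  Node (dec: "(nat, 'i) vec") (noise: "'n option")
    (branches: "(('o \<times> (nat, 'i) vec) \<times> ('i, 'n, 'o) dtree) multiset")

type_synonym ('i, 'n, 'o) tspace = "('i, 'n, 'o) dtree \<Rightarrow>\<^sub>0 real"

lemma size_branch: "x \<in># C \<Longrightarrow> size (snd x) < size (Node k l C)"
proof -
  assume "x \<in># C"
  then obtain D where "C = add_mset x D" by (meson multi_member_split)
  then show ?thesis by (cases x) simp
qed

definition mfact :: "(nat, 'i::finite) vec \<Rightarrow> real"
  where "mfact k = (\<Prod>r\<in>UNIV. fact (k $ r))"

function symm :: "('i::finite, 'n, 'o) dtree \<Rightarrow> real"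
  where "symm (Node k l C) =
    mfact k * (\<Prod>x\<in>set_mset C. symm (snd x) ^ count C x * fact (count C x))"
  by pat_completeness auto
termination by (relation "Wellfounded.measure size") (auto intro: size_branch simp del: dtree.size)

definition tinner :: "('i::finite, 'n, 'o) tspace \<Rightarrow> ('i, 'n, 'o) tspace \<Rightarrow> real"
  where "tinner x y = lin_ext (\<lambda>\<sigma>. lin_ext (\<lambda>\<tau>. if \<sigma> = \<tau> then symm \<tau> else 0) y) x"

definition tinner2 ::
  "(('i::finite, 'n, 'o) dtree \<times> ('i, 'n, 'o) dtree \<Rightarrow>\<^sub>0 real)
    \<Rightarrow> (('i, 'n, 'o) dtree \<times> ('i, 'n, 'o) dtree \<Rightarrow>\<^sub>0 real) \<Rightarrow> real"
  where "tinner2 x y = lin_ext (\<lambda>(\<sigma>\<^sub>1, \<sigma>\<^sub>2). lin_ext (\<lambda>(\<tau>\<^sub>1, \<tau>\<^sub>2).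
    tinner (basis \<sigma>\<^sub>1) (basis \<tau>\<^sub>1) * tinner (basis \<sigma>\<^sub>2) (basis \<tau>\<^sub>2)) y) x"

definition is_adjoint ::
  "(('i::finite, 'n, 'o) tspace \<Rightarrow> ('i, 'n, 'o) tspace)
    \<Rightarrow> (('i, 'n, 'o) tspace \<Rightarrow> ('i, 'n, 'o) tspace) \<Rightarrow> bool"
  where "is_adjoint R A \<longleftrightarrow> (\<forall>\<sigma> \<tau>. tinner (A \<sigma>) \<tau> = tinner \<sigma> (R \<tau>))"


section \<open>Degree\<close>

definition sdeg :: "(nat, 'i::finite) vec \<Rightarrow> (nat, 'i) vec \<Rightarrow> real"
  where "sdeg s p = real (\<Sum>r\<in>UNIV. s $ r * p $ r)"

definition edge_deg :: "(nat, 'i::finite) vec \<Rightarrow> ('o \<Rightarrow> real) \<Rightarrow> ('i, 'o) edge \<Rightarrow> real"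
  where "edge_deg s dp a = dp (fst a) - sdeg s (snd a)"

function tdeg ::
  "(nat, 'i::finite) vec \<Rightarrow> ('n \<Rightarrow> real) \<Rightarrow> ('o \<Rightarrow> real) \<Rightarrow> ('i, 'n, 'o) dtree \<Rightarrow> real"
  where "tdeg s dn dp (Node k l C) =
    sdeg s k + (case l of None \<Rightarrow> 0 | Some t \<Rightarrow> dn t)
      + (\<Sum>x\<in>#C. edge_deg s dp (fst x) + tdeg s dn dp (snd x))"
  by pat_completeness auto
termination
  by (relation "Wellfounded.measure (\<lambda>(s, dn, dp, \<tau>). size \<tau>)") (auto intro: size_branch simp del: dtree.size)

function noises :: "('i::finite, 'n, 'o) dtree \<Rightarrow> nat"
  where "noises (Node k l C) =
    (case l of None \<Rightarrow> 0 | Some t \<Rightarrow> 1) + (\<Sum>x\<in>#C. noises (snd x))"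
  by pat_completeness auto
termination by (relation "Wellfounded.measure size") (auto intro: size_branch simp del: dtree.size)

definition Tplus ::
  "(nat, 'i::finite) vec \<Rightarrow> ('n \<Rightarrow> real) \<Rightarrow> ('o \<Rightarrow> real) \<Rightarrow> ('i, 'n, 'o) tspace set"
  where "Tplus s dn dp = span {basis (Node k None C) | k C.
    \<forall>(a, \<sigma>)\<in>set_mset C. tdeg s dn dp (Node 0 None {#(a, \<sigma>)#}) > 0}"


section \<open>The product \<open>\<star>\<close>\<close>

text \<open>Equal branches of a node are distinguished by numbering their occurrences; a node of a tree
  is then addressed by the sequence of branch occurrences leading to it from the root.\<close>

definition occs :: "'a multiset \<Rightarrow> ('a \<times> nat) set"
  where "occs M = (SIGMA x:set_mset M. {..<count M x})"

lemma finite_occs [simp]: "finite (occs M)"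
  by (simp add: occs_def)

type_synonym ('i, 'n, 'o) occ = "(('i, 'o) edge \<times> ('i, 'n, 'o) dtree) \<times> nat"

function nodes :: "('i::finite, 'n, 'o) dtree \<Rightarrow> ('i, 'n, 'o) occ list set"
  where "nodes (Node k l C) = insert [] (\<Union>y\<in>occs C. Cons y ` nodes (snd (fst y)))"
  by pat_completeness auto
termination
  by (relation "Wellfounded.measure size") (auto intro: size_branch simp: occs_def simp del: dtree.size)

fun dec_at :: "('i::finite, 'n, 'o) dtree \<Rightarrow> ('i, 'n, 'o) occ list \<Rightarrow> (nat, 'i) vec"
  where
    "dec_at \<tau> [] = dec \<tau>"
  | "dec_at \<tau> (y # u) = dec_at (snd (fst y)) u"

text \<open>Replace the decoration of each node \<open>u\<close> by \<open>\<nu> u\<close> and attach the further branches \<open>\<gamma> u\<close> to it.\<close>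

function modify ::
  "(('i::finite, 'n, 'o) occ list \<Rightarrow> (nat, 'i) vec)
    \<Rightarrow> (('i, 'n, 'o) occ list \<Rightarrow> (('i, 'o) edge \<times> ('i, 'n, 'o) dtree) multiset)
    \<Rightarrow> ('i, 'n, 'o) dtree \<Rightarrow> ('i, 'n, 'o) dtree"
  where "modify \<nu> \<gamma> (Node k l C) = Node (\<nu> []) l
    (\<gamma> [] + image_mset
      (\<lambda>y. (fst (fst y), modify (\<lambda>u. \<nu> (y # u)) (\<lambda>u. \<gamma> (y # u)) (snd (fst y))))
      (mset_set (occs C)))"
  by pat_completeness auto
termination
  by (relation "Wellfounded.measure (\<lambda>(\<nu>, \<gamma>, \<tau>). size \<tau>)")
    (auto intro: size_branch simp: occs_def simp del: dtree.size)

text \<open>For \<open>\<sigma> = X\<^sup>k \<Prod>\<^sub>i \<I>\<^bsub>a\<^sub>i\<^esub>(\<sigma>\<^sub>i)\<close> the index \<open>i\<close> runs over the branch occurrences of \<open>\<sigma>\<close>, and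
  \<open>v\<close> assigns to it the node of \<open>\<tau>\<close> to which \<open>\<sigma>\<^sub>i\<close> is grafted. The families \<open>m\<close> that
  contribute zero are left out of the sum, which is then finite.
  The operator \<open>\<up>\<^sup>k\<close> is expanded by distributivity: \<open>\<Prod>\<^sub>r (\<Sum>\<^sub>u \<up>\<^sub>u\<^bsup>e\<^sub>r\<^esup>)\<^bsup>k\<^sub>r\<^esup>\<close> is the sum, over all
  maps \<open>w\<close> sending each of the \<open>k\<^sub>r\<close> factors of each index \<open>r\<close> to a node, of the composition of
  the operators \<open>\<up>\<^sub>u\<^bsup>e\<^sub>r\<^esup>\<close> with \<open>u = w (r, j)\<close>.\<close>

definition load ::
  "'e multiset \<Rightarrow> ('e \<times> nat \<Rightarrow> 'u) \<Rightarrow> ('e \<times> nat \<Rightarrow> (nat, 'i::finite) vec) \<Rightarrow> 'u \<Rightarrow> (nat, 'i) vec"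
  where "load C v m u = (\<Sum>i\<in>{i\<in>occs C. v i = u}. m i)"

definition shifts ::
  "(('i::finite, 'o) edge \<times> ('i, 'n, 'o) dtree) multiset \<Rightarrow> ('i, 'n, 'o) dtree
    \<Rightarrow> (('i, 'n, 'o) occ \<Rightarrow> ('i, 'n, 'o) occ list) \<Rightarrow> (('i, 'n, 'o) occ \<Rightarrow> (nat, 'i) vec) set"
  where "shifts C \<tau> v = {m \<in> occs C \<rightarrow>\<^sub>E UNIV.
    (\<forall>u\<in>nodes \<tau>. load C v m u \<le> dec_at \<tau> u) \<and> (\<forall>i\<in>occs C. m i \<le> snd (fst (fst i)))}"

definition graft_coeff ::
  "(('i::finite, 'o) edge \<times> ('i, 'n, 'o) dtree) multiset \<Rightarrow> ('i, 'n, 'o) dtree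
    \<Rightarrow> (('i, 'n, 'o) occ \<Rightarrow> ('i, 'n, 'o) occ list) \<Rightarrow> (('i, 'n, 'o) occ \<Rightarrow> (nat, 'i) vec) \<Rightarrow> real"
  where "graft_coeff C \<tau> v m = (\<Prod>u\<in>nodes \<tau>. mfact (dec_at \<tau> u)
    / (mfact (dec_at \<tau> u - load C v m u) * (\<Prod>i\<in>{i\<in>occs C. v i = u}. mfact (m i))))"

definition grafts ::
  "(('i::finite, 'o) edge \<times> ('i, 'n, 'o) dtree) multiset
    \<Rightarrow> (('i, 'n, 'o) occ \<Rightarrow> ('i, 'n, 'o) occ list) \<Rightarrow> (('i, 'n, 'o) occ \<Rightarrow> (nat, 'i) vec)
    \<Rightarrow> ('i, 'n, 'o) occ list \<Rightarrow> (('i, 'o) edge \<times> ('i, 'n, 'o) dtree) multiset"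
  where "grafts C v m u = image_mset
    (\<lambda>i. case i of (((t, p), \<sigma>), j) \<Rightarrow> ((t, p - m i), \<sigma>)) (mset_set {i\<in>occs C. v i = u})"

definition slots :: "(nat, 'i::finite) vec \<Rightarrow> ('i \<times> nat) set"
  where "slots k = (SIGMA r:UNIV. {..<k $ r})"

definition raised :: "(nat, 'i::finite) vec \<Rightarrow> ('i \<times> nat \<Rightarrow> 'u) \<Rightarrow> 'u \<Rightarrow> (nat, 'i) vec"
  where "raised k w u = (\<Sum>q\<in>{q\<in>slots k. w q = u}. axis (fst q) 1)"

text \<open>Only used when the root of \<open>\<sigma>\<close> carries no noise.\<close>

definition star_tree ::
  "('i::finite, 'n, 'o) dtree \<Rightarrow> ('i, 'n, 'o) dtree \<Rightarrow> ('i, 'n, 'o) tspace"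
  where "star_tree \<sigma> \<tau> = (let k = dec \<sigma>; C = branches \<sigma> in
    \<Sum>v\<in>occs C \<rightarrow>\<^sub>E nodes \<tau>. \<Sum>m\<in>shifts C \<tau> v. \<Sum>w\<in>slots k \<rightarrow>\<^sub>E nodes \<tau>.
      graft_coeff C \<tau> v m *\<^sub>R
        basis (modify (\<lambda>u. dec_at \<tau> u - load C v m u + raised k w u) (grafts C v m) \<tau>))"

definition star ::
  "('i::finite, 'n, 'o) tspace \<Rightarrow> ('i, 'n, 'o) tspace \<Rightarrow> ('i, 'n, 'o) tspace" (infixl \<open>\<star>\<close> 70)
  where "x \<star> y = lin_ext (\<lambda>\<sigma>. lin_ext (\<lambda>\<tau>. star_tree \<sigma> \<tau>) y) x"

definition is_coproduct ::
  "(nat, 'i::finite) vec \<Rightarrow> ('n \<Rightarrow> real) \<Rightarrow> ('o \<Rightarrow> real)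
    \<Rightarrow> (('i, 'n, 'o) tspace \<Rightarrow> (('i, 'n, 'o) dtree \<times> ('i, 'n, 'o) dtree \<Rightarrow>\<^sub>0 real)) \<Rightarrow> bool"
  where "is_coproduct s dn dp \<Delta> \<longleftrightarrow> linear \<Delta>
    \<and> (\<forall>\<mu>. \<Delta> \<mu> \<in> span {tensor \<tau> \<sigma> | \<tau> \<sigma>. \<sigma> \<in> Tplus s dn dp})
    \<and> (\<forall>\<sigma>\<in>Tplus s dn dp. \<forall>\<tau> \<mu>. tinner (\<sigma> \<star> \<tau>) \<mu> = tinner2 (tensor \<tau> \<sigma>) (\<Delta> \<mu>))"

text \<open>Such a map is unique by nondegeneracy of the inner products. It exists because, for a fixed tree
  \<open>\<mu>\<close>, the condition on degrees in \<open>T\<^sub>+\<close> bounds the edge decorations \<open>a\<^sub>i\<close>, so that \<open>\<mu>\<close> occurs in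
  \<open>\<sigma> \<star> \<tau>\<close> for finitely many pairs of trees only.\<close>

definition coproduct ::
  "(nat, 'i::finite) vec \<Rightarrow> ('n \<Rightarrow> real) \<Rightarrow> ('o \<Rightarrow> real)
    \<Rightarrow> ('i, 'n, 'o) tspace \<Rightarrow> (('i, 'n, 'o) dtree \<times> ('i, 'n, 'o) dtree \<Rightarrow>\<^sub>0 real)"
  where "coproduct s dn dp = (THE \<Delta>. is_coproduct s dn dp \<Delta>)"


section \<open>Preparation maps\<close>

definition preparation_map ::
  "(nat, 'i::finite) vec \<Rightarrow> ('n \<Rightarrow> real) \<Rightarrow> ('o \<Rightarrow> real)
    \<Rightarrow> (('i, 'n, 'o) tspace \<Rightarrow> ('i, 'n, 'o) tspace) \<Rightarrow> bool"
  where "preparation_map s dn dp R \<longleftrightarrow> linear R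
    \<and> (\<forall>\<tau>. \<exists>I c. finite I
        \<and> R (basis \<tau>) = basis \<tau> + (\<Sum>\<sigma>\<in>I. c \<sigma> *\<^sub>R basis \<sigma>)
        \<and> (\<forall>\<sigma>\<in>I. tdeg s dn dp \<sigma> \<ge> tdeg s dn dp \<tau> \<and> noises \<sigma> < noises \<tau>))
    \<and> tensor_map R id \<circ> coproduct s dn dp = coproduct s dn dp \<circ> R"

text \<open>The adjoint \<open>A\<close> of \<open>R\<close> is passed explicitly, since its existence is part of the hypothesis;
  it is unique because the inner product is positive definite.\<close>

definition strong_preparation_map ::
  "(nat, 'i::finite) vec \<Rightarrow> ('n \<Rightarrow> real) \<Rightarrow> ('o \<Rightarrow> real)
    \<Rightarrow> (('i, 'n, 'o) tspace \<Rightarrow> ('i, 'n, 'o) tspace)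
    \<Rightarrow> (('i, 'n, 'o) tspace \<Rightarrow> ('i, 'n, 'o) tspace) \<Rightarrow> bool"
  where "strong_preparation_map s dn dp R A \<longleftrightarrow> preparation_map s dn dp R \<and> is_adjoint R A
    \<and> (\<forall>k C \<tau>. A (basis (Node k None C) \<star> \<tau>) = basis (Node k None C) \<star> A \<tau>)"


section \<open>Elementary differentials\<close>

text \<open>For \<open>a = (t, p)\<close> the variable \<open>Z\<^sub>a\<close> takes values in \<open>\<real>\<^bsup>dm t\<^esup>\<close>, and
  \<open>(a, c)\<close> with \<open>c < dm t\<close> stands for its component \<open>c\<close>. The scalar case is \<open>dm t = 1\<close>.\<close>

type_synonym ('i, 'o) var = "('i, 'o) edge \<times> nat"
type_synonym 'v field = "('v \<Rightarrow> real) \<Rightarrow> real"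

definition pdiff :: "'v \<Rightarrow> 'v field \<Rightarrow> 'v field"
  where "pdiff v f = (\<lambda>Z. deriv (\<lambda>x. f (Z(v := x))) (Z v))"

text \<open>Smoothness is existence and continuity of all iterated partial derivatives.
  For a function of finitely many variables, continuity for the product topology is
  continuity in these variables.\<close>

definition smooth_in :: "'v set \<Rightarrow> 'v field \<Rightarrow> bool"
  where "smooth_in V f \<longleftrightarrow>
    (\<forall>Z Z'. (\<forall>v\<in>V. Z v = Z' v) \<longrightarrow> f Z = f Z')
    \<and> (\<forall>vs. continuous_on UNIV (foldr pdiff vs f)
        \<and> (\<forall>v Z. (\<lambda>x. foldr pdiff vs f (Z(v := x))) differentiable at (Z v)))"

definition tderiv :: "('o \<Rightarrow> nat) \<Rightarrow> 'i::finite \<Rightarrow> ('i, 'o) var field \<Rightarrow> ('i, 'o) var field"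
  where "tderiv dm r f = (\<lambda>Z. Sum_any (\<lambda>a. \<Sum>c<dm (fst a).
    Z ((fst a, snd a + axis r 1), c) * pdiff (a, c) f Z))"

text \<open>The linear order on \<open>'i\<close> only fixes the order \<open>\<partial>\<^sub>1\<^bsup>k\<^sub>1\<^esup> \<dots> \<partial>\<^bsub>d+1\<^esub>\<^bsup>k\<^bsub>d+1\<^esub>\<^esup>\<close> of composition.\<close>

definition tderivs ::
  "('o \<Rightarrow> nat) \<Rightarrow> (nat, 'i::{finite,linorder}) vec \<Rightarrow> ('i, 'o) var field \<Rightarrow> ('i, 'o) var field"
  where "tderivs dm k = foldr (\<lambda>r. tderiv dm r ^^ (k $ r)) (sorted_list_of_set UNIV)"

text \<open>For \<open>xs = [(a\<^sub>1, h\<^sub>1), \<dots>, (a\<^sub>n, h\<^sub>n)]\<close> this is \<open>(\<partial>\<^sup>k D\<^bsub>a\<^sub>1\<^esub> \<dots> D\<^bsub>a\<^sub>n\<^esub> f) \<Prod>\<^sub>j h\<^sub>j\<close>, where \<open>h\<^sub>j\<close>,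
  given by its components, takes values in \<open>\<real>\<^bsup>dm t\<^esup>\<close> for \<open>a\<^sub>j = (t, p)\<close>, and the product is
  the evaluation of the multilinear map \<open>\<partial>\<^sup>k D\<^bsub>a\<^sub>1\<^esub> \<dots> D\<^bsub>a\<^sub>n\<^esub> f\<close> at \<open>(h\<^sub>1, \<dots>, h\<^sub>n)\<close>, written in components.\<close>

definition diff_prod ::
  "('o \<Rightarrow> nat) \<Rightarrow> (nat, 'i::{finite,linorder}) vec
    \<Rightarrow> (('i, 'o) edge \<times> (nat \<Rightarrow> ('i, 'o) var field)) list
    \<Rightarrow> ('i, 'o) var field \<Rightarrow> ('i, 'o) var field"
  where "diff_prod dm k xs f = (\<lambda>Z.
    \<Sum>c\<in>(\<Pi>\<^sub>E j\<in>{..<length xs}. {..<dm (fst (fst (xs ! j)))}).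
      tderivs dm k (foldr (\<lambda>j. pdiff (fst (xs ! j), c j)) [0..<length xs] f) Z
        * (\<Prod>j<length xs. snd (xs ! j) (c j) Z))"

lemma set_some_mset: "x \<in> set (SOME xs. mset xs = C) \<Longrightarrow> x \<in># C"
  by (metis (mono_tags, lifting) ex_mset set_mset_mset someI_ex)

text \<open>\<open>elem_diff dm F \<tau> i c\<close> is component \<open>c\<close> of \<open>F\<^sub>i(\<tau>)\<close>, where \<open>F i l c\<close> is component \<open>c\<close> of
  \<open>F\<^sub>i\<^sup>l\<close>. The branches may be listed in any order, as partial derivatives of smooth functions
  commute.\<close>

function elem_diff ::
  "('o \<Rightarrow> nat) \<Rightarrow> ('o \<Rightarrow> 'n option \<Rightarrow> nat \<Rightarrow> ('i, 'o) var field)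
    \<Rightarrow> ('i::{finite,linorder}, 'n, 'o) dtree \<Rightarrow> 'o \<Rightarrow> nat \<Rightarrow> ('i, 'o) var field"
  where "elem_diff dm F (Node k l C) = (\<lambda>i c.
    diff_prod dm k
      (map (\<lambda>x. (fst x, elem_diff dm F (snd x) (fst (fst x)))) (SOME xs. mset xs = C))
      (F i l c))"
  by pat_completeness auto
termination
  by (relation "Wellfounded.measure (\<lambda>(dm, F, \<tau>). size \<tau>)")
    (auto intro: size_branch dest: set_some_mset simp del: dtree.size)

definition elem_diff_lin ::
  "('o \<Rightarrow> nat) \<Rightarrow> ('o \<Rightarrow> 'n option \<Rightarrow> nat \<Rightarrow> ('i, 'o) var field)
    \<Rightarrow> ('i::{finite,linorder}, 'n, 'o) tspace \<Rightarrow> 'o \<Rightarrow> nat \<Rightarrow> ('i, 'o) var field"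
  where "elem_diff_lin dm F x i c = (\<lambda>Z. lin_ext (\<lambda>\<tau>. elem_diff dm F \<tau> i c Z) x)"

end

theory Submission
  imports Defs
begin

text \<open>Since \<open>X\<^sup>k \<zeta>\<^sub>l \<Prod>\<^sub>j \<I>\<^bsub>a\<^sub>j\<^esub>(\<tau>\<^sub>j) = \<sigma> \<star> \<zeta>\<^sub>l\<close> for \<open>\<sigma> = X\<^sup>k \<Prod>\<^sub>j \<I>\<^bsub>a\<^sub>j\<^esub>(\<tau>\<^sub>j)\<close>, the adjoint of a strong preparation map
  sends it to \<open>\<sigma> \<star> R\<^sup>* \<zeta>\<^sub>l\<close>. It remains to see that
  \<open>F\<^sub>i(\<sigma> \<star> \<mu>) = (\<partial>\<^sup>k D\<^bsub>a\<^sub>1\<^esub> \<dots> D\<^bsub>a\<^sub>n\<^esub> F\<^sub>i(\<mu>)) \<Prod>\<^sub>j F(\<tau>\<^sub>j)\<close> for every tree \<open>\<mu>\<close>. Now \<open>F\<^sub>i(\<mu>)\<close> is a product over the nodes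
  of \<open>\<mu>\<close>, and the \<open>\<partial>\<^sub>r\<close> and \<open>D\<^sub>a\<close> are derivations: the Leibniz rule distributes them over the nodes, and
  moving \<open>D\<^bsub>(t,p)\<^esub>\<close> past \<open>\<partial>\<^sup>n\<close> with \<open>[D\<^bsub>(t,p)\<^esub>, \<partial>\<^sub>r] = D\<^bsub>(t,p - e\<^sub>r)\<^esub>\<close> gives the terms of \<open>\<star>\<close>.\<close>

section \<open>Smooth functions of finitely many variables\<close>

text \<open>The first obstacle is the carrier of the algebra. \<open>pdiff\<close> and
  \<open>tderiv\<close> are defined on arbitrary functions through \<open>deriv\<close> and
  \<open>Sum_any\<close>; the Leibniz rule and commutation hold only where these behave well. The
  computation therefore takes place in a commutative algebra of smooth functions, on which all D_a
  and \<partial>_r are everywhere defined derivations, and returns to plain functions at the end.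
  Distributing derivatives over the nodes leaves operators at single nodes that are not yet of the
  form \<partial>^n after some D_a, so that no tree describes the intermediate expressions. This
  calls for products over the nodes with an arbitrary operator at each of them. The multinomial
  coefficient of a simultaneous grafting comes from binomial ones: the branches are grafted one at a
  time, each drawing its shift from what the earlier ones left of the decoration, and the product
  telescopes. Finally, \<partial>^k and the D_a act on F_i(\<mu>) but never on the factors
  F(\<tau>_j). These factors stay outside, with explicit sums over their components; this mirrors
  the rule that grafting and raising use only the nodes of \<mu>.\<close>

lemma mixed_difference:
  fixes g g1 g12 :: "real \<Rightarrow> real \<Rightarrow> real"
  assumes "\<And>x y. ((\<lambda>x. g x y) has_field_derivative g1 x y) (at x)"
    and "\<And>x y. ((\<lambda>y. g1 x y) has_field_derivative g12 x y) (at y)"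
    and "h > 0"
  obtains x y where "a < x" "x < a + h" "b < y" "y < b + h"
    and "g (a + h) (b + h) - g (a + h) b - g a (b + h) + g a b = h * h * g12 x y"
proof -
  \<comment> \<open>Mean value theorem for \<open>g x (b + h) - g x b\<close> as a function of
    \<open>x\<close>; the next one treats \<open>g1 x\<close> as a function of its second
    argument.\<close>
  have "\<exists>x>a. x < a + h \<and> (g (a + h) (b + h) - g (a + h) b) - (g a (b + h) - g a b)
      = (a + h - a) * (g1 x (b + h) - g1 x b)"
    by (rule MVT2) (use \<open>h > 0\<close> in \<open>auto intro!: derivative_intros assms\<close>)
  then obtain x where x: "a < x" "x < a + h"
    "(g (a + h) (b + h) - g (a + h) b) - (g a (b + h) - g a b) = h * (g1 x (b + h) - g1 x b)"
    by auto
  have "\<exists>y>b. y < b + h \<and> g1 x (b + h) - g1 x b = (b + h - b) * g12 x y"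
    by (rule MVT2) (use \<open>h > 0\<close> in \<open>auto intro!: assms\<close>)
  then obtain y where "b < y" "y < b + h" "g1 x (b + h) - g1 x b = h * g12 x y"
    by auto
  with x show ?thesis
    by (intro that[of x y]) (auto simp: algebra_simps)
qed

text \<open>Both orders of differentiation express the same double difference over a square of side
  \<open>h\<close>, namely as \<open>h * h\<close> times a mixed derivative at some interior point.
  As the square shrinks to \<open>(a, b)\<close>, continuity of both mixed derivatives there
  identifies the limits. Besides this continuity only derivatives in one variable at a time enter,
  as \<open>smooth_in\<close> provides them.\<close>

lemma mixed_derivatives_eq:
  fixes g gx gy gxy gyx :: "real \<Rightarrow> real \<Rightarrow> real"
  assumes "\<And>x y. ((\<lambda>x. g x y) has_field_derivative gx x y) (at x)"
    and "\<And>x y. ((\<lambda>y. gx x y) has_field_derivative gxy x y) (at y)"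
    and "\<And>x y. ((\<lambda>y. g x y) has_field_derivative gy x y) (at y)"
    and "\<And>x y. ((\<lambda>x. gy x y) has_field_derivative gyx x y) (at x)"
    and cont12: "isCont (\<lambda>(x, y). gxy x y) (a, b)"
    and cont21: "isCont (\<lambda>(x, y). gyx x y) (a, b)"
  shows "gxy a b = gyx a b"
proof -
  define h where "h n = 1 / real (Suc n)" for n
  have h: "h n > 0" for n by (simp add: h_def)
  have h0: "h \<longlonglongrightarrow> 0" unfolding h_def by (rule LIMSEQ_Suc[OF lim_1_over_n])
  have "\<exists>x y x' y'. a < x \<and> x < a + h n \<and> b < y \<and> y < b + h n
      \<and> a < x' \<and> x' < a + h n \<and> b < y' \<and> y' < b + h n \<and> gxy x y = gyx x' y'" for n
  proof -
    obtain x y where 1: "a < x" "x < a + h n" "b < y" "y < b + h n"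
      "g (a + h n) (b + h n) - g (a + h n) b - g a (b + h n) + g a b = h n * h n * gxy x y"
      using mixed_difference[OF assms(1,2) h] by metis
    \<comment> \<open>The double difference is symmetric in the two variables, so their roles can be
      exchanged.\<close>
    obtain y' x' where 2: "b < y'" "y' < b + h n" "a < x'" "x' < a + h n"
      "g (a + h n) (b + h n) - g a (b + h n) - g (a + h n) b + g a b = h n * h n * gyx x' y'"
      using mixed_difference[of "\<lambda>y x. g x y" "\<lambda>y x. gy x y" "\<lambda>y x. gyx x y", OF assms(3,4) h]
      by metis
    from 1(5) 2(5) have "h n * h n * gxy x y = h n * h n * gyx x' y'" by linarith
    with h[of n] have "gxy x y = gyx x' y'" by simp
    with 1 2 show ?thesis by blast
  qed
  then obtain x y x' y' where *: "\<And>n. a < x n \<and> x n < a + h n \<and> b < y n \<and> y n < b + h n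
      \<and> a < x' n \<and> x' n < a + h n \<and> b < y' n \<and> y' n < b + h n \<and> gxy (x n) (y n) = gyx (x' n) (y' n)"
    by metis
  have squeeze: "z \<longlonglongrightarrow> c" if "\<And>n. c < z n \<and> z n < c + h n" for z c
  proof (rule tendsto_sandwich[OF _ _ tendsto_const])
    show "(\<lambda>n. c + h n) \<longlonglongrightarrow> c" using tendsto_add[OF tendsto_const h0, of c] by simp
  qed (use that in \<open>auto intro!: always_eventually simp: less_imp_le\<close>)
  have "(\<lambda>n. (\<lambda>(x, y). gxy x y) (x n, y n)) \<longlonglongrightarrow> (\<lambda>(x, y). gxy x y) (a, b)"
    using * by (intro isCont_tendsto_compose[OF cont12] tendsto_Pair squeeze) auto
  moreover have "(\<lambda>n. (\<lambda>(x, y). gyx x y) (x' n, y' n)) \<longlonglongrightarrow> (\<lambda>(x, y). gyx x y) (a, b)"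
    using * by (intro isCont_tendsto_compose[OF cont21] tendsto_Pair squeeze) auto
  ultimately show ?thesis
    using * LIMSEQ_unique by fastforce
qed

text \<open>Each \<partial>_r multiplies by coordinates, and the Leibniz rule creates sums and
  products. Closing inductively makes stability under these a constructor, where
  \<open>smooth_in\<close> alone would ask for all iterated partial derivatives of a
  product.\<close>

inductive smooth_field :: "'v field \<Rightarrow> bool"
  where
    smooth: "finite V \<Longrightarrow> smooth_in V f \<Longrightarrow> smooth_field f"
  | const: "smooth_field (\<lambda>Z. r)"
  | coord: "smooth_field (\<lambda>Z. Z v)"
  | add: "smooth_field f \<Longrightarrow> smooth_field g \<Longrightarrow> smooth_field (\<lambda>Z. f Z + g Z)"
  | mult: "smooth_field f \<Longrightarrow> smooth_field g \<Longrightarrow> smooth_field (\<lambda>Z. f Z * g Z)"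

lemma smooth_in_pdiff:
  assumes "smooth_in V f"
  shows "smooth_in V (pdiff v f)"
proof -
  have dep: "f Z = f Z'" if "\<forall>u\<in>V. Z u = Z' u" for Z Z'
    using assms that unfolding smooth_in_def by blast
  have "pdiff v f Z = pdiff v f Z'" if Z: "\<forall>u\<in>V. Z u = Z' u" for Z Z'
  proof (cases "v \<in> V")
    case True
    have "f (Z(v := x)) = f (Z'(v := x))" for x
      by (rule dep) (use Z in auto)
    with True Z show ?thesis by (simp add: pdiff_def)
  next
    case False
    have "f (Z(v := x)) = f Z" "f (Z'(v := x)) = f Z'" for x
      by (rule dep; use False in auto)+
    then show ?thesis by (simp add: pdiff_def)
  qed
  moreover have "foldr pdiff vs (pdiff v f) = foldr pdiff (vs @ [v]) f" for vs
    by simp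
  ultimately show ?thesis
    using assms unfolding smooth_in_def by metis
qed

lemma smooth_field_differentiable_at:
  assumes "smooth_field f"
  shows "(\<lambda>x. f (Z(v := x))) differentiable at y"
  using assms
proof (induction rule: smooth_field.induct)
  case (smooth V f)
  then have "(\<lambda>x. foldr pdiff [] f ((Z(v := y))(v := x))) differentiable at ((Z(v := y)) v)"
    unfolding smooth_in_def by blast
  then show ?case by (simp only: foldr.simps id_apply fun_upd_upd fun_upd_same)
next
  case (coord u)
  show ?case by (cases "u = v") auto
qed (auto intro: differentiable_add differentiable_mult)

lemma pdiff_has_derivative:
  assumes "smooth_field f"
  shows "((\<lambda>x. f (Z(v := x))) has_field_derivative pdiff v f (Z(v := y))) (at y)"
proof -
  have "(\<lambda>x. f (Z(v := x))) field_differentiable at y"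
    using smooth_field_differentiable_at[OF assms]
    by (auto simp: real_differentiable_def field_differentiable_def)
  then show ?thesis
    by (simp add: pdiff_def DERIV_deriv_iff_field_differentiable)
qed

lemma pdiff_eqI:
  assumes "((\<lambda>x. f (Z(v := x))) has_field_derivative D) (at (Z v))"
  shows "pdiff v f Z = D"
  using assms by (simp add: pdiff_def DERIV_imp_deriv)

lemma pdiff_const [simp]: "pdiff v (\<lambda>Z. r) = (\<lambda>Z. 0)"
  by (simp add: pdiff_def)

lemma pdiff_coord: "pdiff v (\<lambda>Z. Z u) = (\<lambda>Z. if u = v then 1 else 0)"
  by (rule ext, rule pdiff_eqI) (auto intro!: derivative_eq_intros)

lemma pdiff_has_derivative_at:
  "smooth_field f \<Longrightarrow> ((\<lambda>x. f (Z(v := x))) has_field_derivative pdiff v f Z) (at (Z v))"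
  using pdiff_has_derivative[of f Z v "Z v"] by simp

lemma pdiff_add:
  assumes "smooth_field f" "smooth_field g"
  shows "pdiff v (\<lambda>Z. f Z + g Z) = (\<lambda>Z. pdiff v f Z + pdiff v g Z)"
  by (rule ext, rule pdiff_eqI)
    (auto intro!: derivative_eq_intros pdiff_has_derivative_at assms)

lemma pdiff_mult:
  assumes "smooth_field f" "smooth_field g"
  shows "pdiff v (\<lambda>Z. f Z * g Z) = (\<lambda>Z. pdiff v f Z * g Z + f Z * pdiff v g Z)"
  by (rule ext, rule pdiff_eqI)
    (auto intro!: derivative_eq_intros pdiff_has_derivative_at assms)

lemma smooth_field_pdiff: "smooth_field f \<Longrightarrow> smooth_field (pdiff v f)"
proof (induction rule: smooth_field.induct)
  case (smooth V f)
  then show ?case by (auto intro: smooth_field.smooth smooth_in_pdiff)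
next
  case (coord u)
  show ?case unfolding pdiff_coord by (rule smooth_field.const)
qed (auto simp: pdiff_add pdiff_mult intro!: smooth_field.intros)

lemma continuous_smooth_field: "smooth_field f \<Longrightarrow> continuous_on UNIV f"
proof (induction rule: smooth_field.induct)
  case (smooth V f)
  then have "continuous_on UNIV (foldr pdiff [] f)" unfolding smooth_in_def by blast
  then show ?case by simp
next
  case (coord v)
  show ?case by (rule continuous_on_product_coordinates)
qed (auto intro: continuous_on_add continuous_on_mult)

text \<open>Turns the formally infinite sum defining \<partial>_r into a finite one;
  \<open>Sum_any\<close> would return 0 on an infinite support.\<close>

lemma finite_support_smooth_field:
  "smooth_field f \<Longrightarrow> finite {v. pdiff v f \<noteq> (\<lambda>Z. 0)}"
proof (induction rule: smooth_field.induct)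
  case (smooth V f)
  have "pdiff v f = (\<lambda>Z. 0)" if "v \<notin> V" for v
  proof
    fix Z
    have "f (Z(v := x)) = f Z" for x
      using smooth(2) that unfolding smooth_in_def by (metis fun_upd_other)
    then show "pdiff v f Z = 0" by (simp add: pdiff_def)
  qed
  then have "{v. pdiff v f \<noteq> (\<lambda>Z. 0)} \<subseteq> V" by blast
  with smooth(1) show ?case by (rule finite_subset[rotated])
next
  case (coord u)
  show ?case by (rule finite_subset[of _ "{u}"]) (auto simp: pdiff_coord)
next
  case (add f g)
  show ?case
    by (rule finite_subset[OF _ finite_UnI[OF add.IH]]) (auto simp: pdiff_add[OF add.hyps])
next
  case (mult f g)
  show ?case
    by (rule finite_subset[OF _ finite_UnI[OF mult.IH]]) (auto simp: pdiff_mult[OF mult.hyps])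
qed simp

text \<open>Restriction to the plane through \<open>Z\<close> in which only \<open>u\<close> and
  \<open>v\<close> vary reduces this to two real variables. Continuity for the product topology
  becomes joint continuity on that plane, because the embedding \<open>S\<close> is continuous
  coordinate by coordinate.\<close>

lemma pdiff_commute:
  fixes f :: "'a field"
  assumes f: "smooth_field f"
  shows "pdiff u (pdiff v f) = pdiff v (pdiff u f)"
proof (cases "u = v")
  case False
  show ?thesis
  proof
    fix Z
    define S where "S x y = Z(u := x, v := y)" for x y :: real
    have S_swap: "S x y = Z(v := y, u := x)" for x y
      using False by (simp add: S_def fun_upd_twist)
    have along_u: "((\<lambda>x. h (S x y)) has_field_derivative pdiff u h (S x y)) (at x)"
      if "smooth_field h" for h :: "'a field" and x y
      unfolding S_swap by (rule pdiff_has_derivative[OF that])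
    have along_v: "((\<lambda>y. h (S x y)) has_field_derivative pdiff v h (S x y)) (at y)"
      if "smooth_field h" for h :: "'a field" and x y
      unfolding S_def by (rule pdiff_has_derivative[OF that])
    have cont_S: "continuous_on UNIV (\<lambda>p. S (fst p) (snd p))"
    proof (rule continuous_on_coordinatewise_then_product)
      fix w
      have "continuous_on UNIV (\<lambda>p. if w = v then snd p else if w = u then fst p else Z w)"
        by (cases "w = v"; cases "w = u") (auto intro: continuous_intros)
      then show "continuous_on UNIV (\<lambda>p. S (fst p) (snd p) w)"
        by (simp add: S_def fun_upd_def)
    qed
    have cont: "isCont (\<lambda>(x, y). h (S x y)) (a, b)" if "smooth_field h" for h :: "'a field" and a b
    proof -
      have "continuous_on UNIV (\<lambda>p. h (S (fst p) (snd p)))"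
        by (rule continuous_on_compose2[OF continuous_smooth_field[OF that] cont_S]) simp
      then show ?thesis
        by (simp add: continuous_on_eq_continuous_at case_prod_unfold)
    qed
    have "pdiff v (pdiff u f) (S (Z u) (Z v)) = pdiff u (pdiff v f) (S (Z u) (Z v))"
      by (rule mixed_derivatives_eq[where g = "\<lambda>x y. f (S x y)"
            and gx = "\<lambda>x y. pdiff u f (S x y)" and gy = "\<lambda>x y. pdiff v f (S x y)"
            and gxy = "\<lambda>x y. pdiff v (pdiff u f) (S x y)"
            and gyx = "\<lambda>x y. pdiff u (pdiff v f) (S x y)"])
        (intro along_u along_v cont smooth_field_pdiff f)+
    then show "pdiff u (pdiff v f) Z = pdiff v (pdiff u f) Z" by (simp add: S_def)
  qed
qed simp


section \<open>The algebra of smooth functions and its derivations\<close>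

text \<open>Moving smoothness into the type makes finite sums, products and linear maps available
  without side conditions.\<close>

typedef 'v sfield = "{f :: 'v field. smooth_field f}"
  morphisms apply_sfield Abs_sfield
  by (auto intro: smooth_field.const)

setup_lifting type_definition_sfield

lemma smooth_apply_sfield: "smooth_field (apply_sfield f)"
  using apply_sfield by blast

instantiation sfield :: (type) comm_ring_1
begin

lift_definition zero_sfield :: "'a sfield" is "\<lambda>Z. 0" by (rule smooth_field.const)
lift_definition one_sfield :: "'a sfield" is "\<lambda>Z. 1" by (rule smooth_field.const)
lift_definition plus_sfield :: "'a sfield \<Rightarrow> 'a sfield \<Rightarrow> 'a sfield" is "\<lambda>f g Z. f Z + g Z"
  by (rule smooth_field.add)
lift_definition times_sfield :: "'a sfield \<Rightarrow> 'a sfield \<Rightarrow> 'a sfield" is "\<lambda>f g Z. f Z * g Z"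
  by (rule smooth_field.mult)
text \<open>Negation is multiplication by a constant, so that the constructors of
  \<open>smooth_field\<close> suffice.\<close>

lift_definition uminus_sfield :: "'a sfield \<Rightarrow> 'a sfield" is "\<lambda>f Z. - 1 * f Z"
  by (intro smooth_field.mult smooth_field.const)
definition minus_sfield :: "'a sfield \<Rightarrow> 'a sfield \<Rightarrow> 'a sfield" where "minus_sfield f g = f + - g"

instance
  by standard (unfold minus_sfield_def, (transfer; simp add: fun_eq_iff algebra_simps)+)

end

instantiation sfield :: (type) real_algebra_1
begin

lift_definition scaleR_sfield :: "real \<Rightarrow> 'a sfield \<Rightarrow> 'a sfield" is "\<lambda>r f Z. r * f Z"
  by (intro smooth_field.mult smooth_field.const)

instance
  by standard (transfer; simp add: fun_eq_iff algebra_simps)+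

end

section \<open>Evaluation, derivations and partial derivatives on the algebra\<close>

lemma apply_sfield_sum: "apply_sfield (\<Sum>i\<in>S. f i) Z = (\<Sum>i\<in>S. apply_sfield (f i) Z)"
  by (induction S rule: infinite_finite_induct) (auto simp: zero_sfield.rep_eq plus_sfield.rep_eq)

lemma apply_sfield_prod: "apply_sfield (\<Prod>i\<in>S. f i) Z = (\<Prod>i\<in>S. apply_sfield (f i) Z)"
  by (induction S rule: infinite_finite_induct) (auto simp: one_sfield.rep_eq times_sfield.rep_eq)

text \<open>Common to \<open>partial\<close> and \<open>total_deriv\<close>, so that the Leibniz
  rule over the nodes of a tree is proved once for both.\<close>

definition derivation :: "('a::real_algebra_1 \<Rightarrow> 'a) \<Rightarrow> bool"
  where "derivation d \<longleftrightarrow> linear d \<and> (\<forall>f g. d (f * g) = d f * g + f * d g)"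

lemma derivation_linear: "derivation d \<Longrightarrow> linear d"
  by (simp add: derivation_def)

lemma derivation_mult: "derivation d \<Longrightarrow> d (f * g) = d f * g + f * d g"
  by (simp add: derivation_def)

lemma derivation_one: "derivation d \<Longrightarrow> d 1 = 0"
  using derivation_mult[of d 1 1] by simp

lemma derivation_prod:
  fixes f :: "'i \<Rightarrow> 'a::{comm_ring_1, real_algebra_1}"
  assumes d: "derivation d" and "finite S"
  shows "d (\<Prod>i\<in>S. f i) = (\<Sum>i\<in>S. d (f i) * (\<Prod>j\<in>S - {i}. f j))"
  using \<open>finite S\<close>
proof (induction S rule: finite_induct)
  case (insert x S)
  have "insert x S - {i} = insert x (S - {i})" if "i \<in> S" for i
    using insert that by auto
  then have "(\<Sum>i\<in>S. d (f i) * (\<Prod>j\<in>insert x S - {i}. f j))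
      = f x * (\<Sum>i\<in>S. d (f i) * (\<Prod>j\<in>S - {i}. f j))"
    using insert unfolding sum_distrib_left by (intro sum.cong) (auto simp: mult_ac)
  moreover have "insert x S - {x} = S" using insert by auto
  ultimately show ?case
    using insert by (simp add: derivation_mult[OF d])
qed (simp add: derivation_one[OF d])

lift_definition partial :: "'v \<Rightarrow> 'v sfield \<Rightarrow> 'v sfield" is pdiff
  by (rule smooth_field_pdiff)

lift_definition coordinate :: "'v \<Rightarrow> 'v sfield" is "\<lambda>v Z. Z v"
  by (rule smooth_field.coord)

lemma derivation_partial: "derivation (partial v)"
  unfolding derivation_def
proof (intro conjI linearI allI)
  fix f g :: "'a sfield" and r :: real
  show "partial v (f + g) = partial v f + partial v g"
    by transfer (rule pdiff_add)
  show "partial v (f * g) = partial v f * g + f * partial v g"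
    by transfer (rule pdiff_mult)
  show "partial v (r *\<^sub>R f) = r *\<^sub>R partial v f"
    by transfer (simp add: pdiff_mult smooth_field.const)
qed

lemmas linear_partial = derivation_linear[OF derivation_partial]
lemmas partial_mult = derivation_mult[OF derivation_partial]

lemma partial_commute: "partial u (partial v f) = partial v (partial u f)"
  by transfer (rule pdiff_commute)

lemma partial_coordinate: "partial v (coordinate u) = (if u = v then 1 else 0)"
  by (cases "u = v") (simp_all, (transfer; simp add: pdiff_coord)+)

lemma finite_support_partial: "finite {v. partial v f \<noteq> 0}"
  by transfer (rule finite_support_smooth_field)

text \<open>Indexed by a multiset because the branches at a node are unordered; the recursion for
  the fold rests on \<open>partial_commute\<close>.\<close>

definition partials :: "'v multiset \<Rightarrow> 'v sfield \<Rightarrow> 'v sfield"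
  where "partials M f = fold_mset partial f M"

interpretation partial: comp_fun_commute partial
  by standard (simp add: fun_eq_iff partial_commute)

lemma partials_empty [simp]: "partials {#} f = f"
  by (simp add: partials_def)

lemma partials_add_mset [simp]: "partials (add_mset v M) f = partial v (partials M f)"
  by (simp add: partials_def)

lemma partials_union: "partials (M + N) f = partials M (partials N f)"
  by (induction M) auto

lemma linear_partials: "linear (partials M)"
proof (induction M)
  case empty
  then show ?case by (simp add: linear_iff)
next
  case (add v M)
  have "partials (add_mset v M) = partial v \<circ> partials M" by auto
  then show ?case using linear_compose[OF add linear_partial] by (simp only:)
qed

lemma apply_partials_mset: "apply_sfield (partials (mset vs) f) = foldr pdiff vs (apply_sfield f)"
  by (induction vs) (auto simp: partial.rep_eq)

\<comment> \<open>Otherwise \<open>axis r 1\<close> is rewritten to \<open>axis r (Suc 0)\<close>.\<close>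
declare One_nat_def [simp del]

section \<open>The derivations \<partial>_r and their commutation relations\<close>

lemma axis_nth_nat: "(axis r 1 :: (nat, 'i::finite) vec) $ j = (if j = r then 1 else 0)"
  by (simp add: axis_def)

definition total_deriv ::
  "('o \<Rightarrow> nat) \<Rightarrow> 'i::finite \<Rightarrow> ('i, 'o) var sfield \<Rightarrow> ('i, 'o) var sfield"
  where "total_deriv dm r f = Sum_any (\<lambda>a. \<Sum>c<dm (fst a).
    coordinate ((fst a, snd a + axis r 1), c) * partial (a, c) f)"

text \<open>Collects edges instead of variables, since the outer sum in \<open>total_deriv\<close>
  runs over edges.\<close>

definition edge_support :: "('i::finite, 'o) var sfield \<Rightarrow> ('i, 'o) edge set"
  where "edge_support f = {a. \<exists>c. partial (a, c) f \<noteq> 0}"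

lemma edge_supportD: "a \<notin> edge_support f \<Longrightarrow> partial (a, c) f = 0"
  by (simp add: edge_support_def)

lemma edge_support_subsetI: "(\<And>a c. a \<notin> A \<Longrightarrow> partial (a, c) f = 0) \<Longrightarrow> edge_support f \<subseteq> A"
  by (auto simp: edge_support_def simp del: split_paired_All)

lemma edge_support_partial: "edge_support (partial v f) \<subseteq> edge_support f"
  by (rule edge_support_subsetI)
    (simp add: partial_commute[of _ v] edge_supportD linear_0[OF linear_partial])

lemma finite_edge_support: "finite (edge_support f)"
proof -
  have "edge_support f = fst ` {v. partial v f \<noteq> 0}" by (force simp: edge_support_def)
  then show ?thesis by (simp add: finite_support_partial)
qed

lemma total_deriv_eq_sum:
  assumes "finite A" "edge_support f \<subseteq> A"
  shows "total_deriv dm r f = (\<Sum>a\<in>A. \<Sum>c<dm (fst a).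
    coordinate ((fst a, snd a + axis r 1), c) * partial (a, c) f)"
  unfolding total_deriv_def
proof (rule Sum_any.expand_superset[OF assms(1)])
  show "{a. (\<Sum>c<dm (fst a). coordinate ((fst a, snd a + axis r 1), c) * partial (a, c) f) \<noteq> 0} \<subseteq> A"
    using assms(2) edge_supportD[of _ f] by (force intro!: sum.neutral)
qed

lemma apply_total_deriv: "apply_sfield (total_deriv dm r f) = tderiv dm r (apply_sfield f)"
proof
  fix Z
  let ?A = "edge_support f"
  have "tderiv dm r (apply_sfield f) Z
      = (\<Sum>a\<in>?A. \<Sum>c<dm (fst a). Z ((fst a, snd a + axis r 1), c) * pdiff (a, c) (apply_sfield f) Z)"
    unfolding tderiv_def
  proof (rule Sum_any.expand_superset[OF finite_edge_support])
    have "pdiff (a, c) (apply_sfield f) Z = 0" if "a \<notin> edge_support f" for a c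
      using edge_supportD[OF that] by (metis partial.rep_eq zero_sfield.rep_eq)
    then show "{a. (\<Sum>c<dm (fst a). Z ((fst a, snd a + axis r 1), c)
        * pdiff (a, c) (apply_sfield f) Z) \<noteq> 0} \<subseteq> ?A"
      by (auto intro!: sum.neutral)
  qed
  also have "\<dots> = apply_sfield (total_deriv dm r f) Z"
    unfolding total_deriv_eq_sum[OF finite_edge_support subset_refl]
    by (simp add: apply_sfield_sum times_sfield.rep_eq coordinate.rep_eq partial.rep_eq)
  finally show "apply_sfield (total_deriv dm r f) Z = tderiv dm r (apply_sfield f) Z" ..
qed

lemma derivation_total_deriv: "derivation (total_deriv dm r)"
proof -
  \<comment> \<open>One claim for all three laws: \<open>total_deriv\<close> depends linearly, over
    the ring itself, on the family of partial derivatives, and sums, products and scalar multiples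
    all have partial derivatives of this shape.\<close>
  have comb: "total_deriv dm r h = g1 * total_deriv dm r f1 + g2 * total_deriv dm r f2"
    if h: "\<And>v. partial v h = g1 * partial v f1 + g2 * partial v f2" for h g1 g2 f1 f2
  proof -
    let ?A = "edge_support f1 \<union> edge_support f2"
    have A: "finite ?A" by (intro finite_UnI finite_edge_support)
    have "edge_support h \<subseteq> ?A" by (rule edge_support_subsetI) (simp add: h edge_supportD)
    then show ?thesis
      using A by (simp add: total_deriv_eq_sum[OF A] h sum.distrib sum_distrib_left algebra_simps)
  qed
  show ?thesis
    unfolding derivation_def
  proof (intro conjI linearI allI)
    fix f g :: "('b, 'a) var sfield" and s :: real
    show "total_deriv dm r (f + g) = total_deriv dm r f + total_deriv dm r g"
      using comb[of "f + g" 1 f 1 g] by (simp add: linear_add[OF linear_partial])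
    show "total_deriv dm r (f * g) = total_deriv dm r f * g + f * total_deriv dm r g"
      using comb[of "f * g" g f f g] by (simp add: partial_mult mult.commute)
    show "total_deriv dm r (s *\<^sub>R f) = s *\<^sub>R total_deriv dm r f"
    proof -
      have "partial v (s *\<^sub>R f) = of_real s * partial v f + 0 * partial v f" for v
        unfolding linear_scale[OF linear_partial] by (simp add: scaleR_conv_of_real)
      then show ?thesis using comb[of "s *\<^sub>R f" "of_real s" f 0 f] by (simp add: scaleR_conv_of_real)
    qed
  qed
qed

lemmas linear_total_deriv = derivation_linear[OF derivation_total_deriv]
lemmas total_deriv_mult = derivation_mult[OF derivation_total_deriv]

lemma axis_le_iff: "(axis r 1 :: (nat, 'i::finite) vec) \<le> p \<longleftrightarrow> p $ r \<ge> 1"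
proof
  assume "(axis r 1 :: (nat, 'i) vec) \<le> p"
  then have "(axis r 1 :: (nat, 'i) vec) $ r \<le> p $ r" unfolding less_eq_vec_def by blast
  then show "p $ r \<ge> 1" by (simp add: axis_nth_nat)
qed (simp add: less_eq_vec_def axis_nth_nat)

lemma le_diff_add_vec: "q \<le> p \<Longrightarrow> p - q + q = (p :: (nat, 'i::finite) vec)"
  by (simp add: vec_eq_iff less_eq_vec_def)

text \<open>The extra term arises where D_a falls on a coefficient Z_(b + e_r) with b + e_r = a.
  Such a \<open>b\<close> exists only if \<open>axis r 1 \<le> p\<close>; the guard is needed
  because subtraction is truncated.\<close>

lemma partial_total_deriv:
  assumes "c < dm t"
  shows "partial ((t, p), c) (total_deriv dm r f) = total_deriv dm r (partial ((t, p), c) f)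
    + (if axis r 1 \<le> p then partial ((t, p - axis r 1), c) f else 0)"
proof -
  let ?v = "((t, p), c)" and ?a0 = "(t, p - axis r 1)"
  \<comment> \<open>Adding \<open>?a0\<close> guarantees that the sum meets the exceptional term
    even if \<open>f\<close> does not depend on that edge.\<close>
  let ?A = "insert ?a0 (edge_support f)"
  have A: "finite ?A" by (simp add: finite_edge_support)
  have sub: "edge_support (partial ?v f) \<subseteq> ?A"
    using edge_support_partial by blast
  have hit: "(fst a, snd a + axis r 1) = (t, p) \<longleftrightarrow> axis r 1 \<le> p \<and> a = ?a0" for a :: "('b, 'a) edge"
  proof -
    have "snd a + axis r 1 = p \<Longrightarrow> axis r 1 \<le> p \<and> snd a = p - axis r 1"
      by (auto simp: less_eq_vec_def)
    then show ?thesis by (cases a) (auto simp: le_diff_add_vec)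
  qed
  have "partial ?v (total_deriv dm r f) = (\<Sum>a\<in>?A. \<Sum>c'<dm (fst a).
      coordinate ((fst a, snd a + axis r 1), c') * partial (a, c') (partial ?v f)
      + (if a = ?a0 \<and> c' = c then if axis r 1 \<le> p then partial (?a0, c) f else 0 else 0))"
    unfolding total_deriv_eq_sum[OF A subset_insertI] linear_sum[OF linear_partial] o_def
    using hit
    by (intro sum.cong refl)
      (auto simp: partial_mult partial_coordinate partial_commute[of ?v] simp del: prod.inject)
  also have "\<dots> = total_deriv dm r (partial ?v f)
      + (\<Sum>a\<in>?A. if a = ?a0 then (\<Sum>c'<dm (fst a).
          if c' = c then if axis r 1 \<le> p then partial (?a0, c) f else 0 else 0) else 0)"
    unfolding total_deriv_eq_sum[OF A sub] sum.distrib
    by (intro arg_cong2[of _ _ _ _ "(+)"] refl sum.cong) auto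
  also have "(\<Sum>a\<in>?A. if a = ?a0 then (\<Sum>c'<dm (fst a).
      if c' = c then if axis r 1 \<le> p then partial (?a0, c) f else 0 else 0) else 0)
      = (if axis r 1 \<le> p then partial (?a0, c) f else 0)"
    using assms A by (simp add: sum.delta)
  finally show ?thesis .
qed

lemma total_deriv_coordinate:
  assumes "c < dm (fst a)"
  shows "total_deriv dm r (coordinate (a, c)) = coordinate ((fst a, snd a + axis r 1), c)"
proof -
  have "total_deriv dm r (coordinate (a, c)) = (\<Sum>b\<in>{a}. \<Sum>c'<dm (fst b).
      coordinate ((fst b, snd b + axis r 1), c') * partial (b, c') (coordinate (a, c)))"
    by (rule total_deriv_eq_sum) (auto intro!: edge_support_subsetI simp: partial_coordinate split: if_splits)
  also have "\<dots> = (\<Sum>c'<dm (fst a). if c = c' then coordinate ((fst a, snd a + axis r 1), c') else 0)"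
    by (simp add: partial_coordinate if_distrib[of "\<lambda>x. _ * x"] cong: if_cong)
  finally show ?thesis using assms by simp
qed

lemma nested_sum_swap:
  assumes "finite A" "\<And>a. a \<in> A \<Longrightarrow> finite (B a)"
  shows "(\<Sum>a\<in>A. \<Sum>c\<in>B a. \<Sum>b\<in>A. \<Sum>e\<in>B b. h a c b e) = (\<Sum>b\<in>A. \<Sum>e\<in>B b. \<Sum>a\<in>A. \<Sum>c\<in>B a. h a c b e)"
proof -
  have eq: "(\<Sum>a\<in>A. \<Sum>c\<in>B a. g a c) = (\<Sum>x\<in>Sigma A B. g (fst x) (snd x))" for g :: "'a \<Rightarrow> 'b \<Rightarrow> 'c"
    using assms by (simp add: sum.Sigma split_def)
  show ?thesis
    unfolding eq by (rule sum.swap)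
qed

text \<open>The first order part shifts an edge by both unit vectors and is symmetric in them. The
  second order part is symmetric because partial derivatives commute and the double sum may be
  exchanged.\<close>

lemma total_deriv_commute:
  "total_deriv dm r (total_deriv dm q f) = total_deriv dm q (total_deriv dm r f)"
proof -
  let ?A = "edge_support f"
  let ?z = "\<lambda>a r c. coordinate ((fst a, snd a + axis r 1), c)"
  have expand: "total_deriv dm r (total_deriv dm q f) =
      (\<Sum>a\<in>?A. \<Sum>c<dm (fst a). coordinate ((fst a, snd a + axis q 1 + axis r 1), c) * partial (a, c) f)
      + (\<Sum>a\<in>?A. \<Sum>c<dm (fst a). \<Sum>b\<in>?A. \<Sum>c'<dm (fst b).
          ?z a q c * ?z b r c' * partial (b, c') (partial (a, c) f))" for r q
    unfolding total_deriv_eq_sum[OF finite_edge_support subset_refl, of _ q]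
      linear_sum[OF linear_total_deriv] o_def sum.distrib[symmetric] total_deriv_mult
      total_deriv_eq_sum[OF finite_edge_support edge_support_partial]
    by (intro sum.cong refl) (simp add: total_deriv_coordinate sum_distrib_left mult_ac)
  have "(\<Sum>a\<in>?A. \<Sum>c<dm (fst a). \<Sum>b\<in>?A. \<Sum>c'<dm (fst b).
        ?z a q c * ?z b r c' * partial (b, c') (partial (a, c) f))
      = (\<Sum>b\<in>?A. \<Sum>c'<dm (fst b). \<Sum>a\<in>?A. \<Sum>c<dm (fst a).
        ?z a q c * ?z b r c' * partial (b, c') (partial (a, c) f))"
    by (rule nested_sum_swap) (simp_all add: finite_edge_support)
  also have "\<dots> = (\<Sum>b\<in>?A. \<Sum>c'<dm (fst b). \<Sum>a\<in>?A. \<Sum>c<dm (fst a).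
        ?z b r c' * ?z a q c * partial (a, c) (partial (b, c') f))"
    by (intro sum.cong refl arg_cong2[of _ _ _ _ "(*)"] mult.commute partial_commute)
  finally show ?thesis
    unfolding expand by (simp add: add.commute add.left_commute)
qed


section \<open>Iterated derivatives \<partial>^k and induction over multi-indices\<close>

definition total_derivs ::
  "('o \<Rightarrow> nat) \<Rightarrow> (nat, 'i::{finite,linorder}) vec \<Rightarrow> ('i, 'o) var sfield \<Rightarrow> ('i, 'o) var sfield"
  where "total_derivs dm k = foldr (\<lambda>r. total_deriv dm r ^^ (k $ r)) (sorted_list_of_set UNIV)"

lemma apply_total_derivs:
  fixes k :: "(nat, 'i::{finite,linorder}) vec"
  shows "apply_sfield (total_derivs dm k f) = tderivs dm k (apply_sfield f)"
proof -
  have "apply_sfield ((total_deriv dm r ^^ n) g) = (tderiv dm r ^^ n) (apply_sfield g)" for r :: 'i and n g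
    by (induction n) (auto simp: apply_total_deriv)
  then have "apply_sfield (foldr (\<lambda>r. total_deriv dm r ^^ (k $ r)) rs f)
      = foldr (\<lambda>r. tderiv dm r ^^ (k $ r)) rs (apply_sfield f)" for rs
    by (induction rs) auto
  then show ?thesis by (simp add: total_derivs_def tderivs_def)
qed

lemma total_derivs_0 [simp]:
  fixes f :: "('i::{finite,linorder}, 'o) var sfield"
  shows "total_derivs dm 0 f = f"
proof -
  have "foldr (\<lambda>r. total_deriv dm r ^^ ((0::(nat, 'i) vec) $ r)) rs f = f" for rs
    by (induction rs) auto
  then show ?thesis by (simp add: total_derivs_def)
qed

text \<open>Since the \<partial>_r commute, the additional one can be pulled to the outside from
  wherever \<open>q\<close> stands in the list.\<close>

lemma total_derivs_add_axis:
  fixes k :: "(nat, 'i::{finite,linorder}) vec"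
  shows "total_derivs dm (k + axis q 1) f = total_deriv dm q (total_derivs dm k f)"
proof -
  have pow: "(total_deriv dm r ^^ n) (total_deriv dm q g) = total_deriv dm q ((total_deriv dm r ^^ n) g)"
    for r :: 'i and n g by (induction n) (simp_all add: total_deriv_commute[of dm r q])
  \<comment> \<open>For a general list the extra factor appears only if \<open>q\<close> occurs, and
    distinctness makes it appear once.\<close>
  have "foldr (\<lambda>r. total_deriv dm r ^^ ((k + axis q 1) $ r)) rs f
      = (if q \<in> set rs then total_deriv dm q else id) (foldr (\<lambda>r. total_deriv dm r ^^ (k $ r)) rs f)"
    if "distinct rs" for rs
    using that
  proof (induction rs)
    case (Cons r rs)
    have "total_deriv dm q ^^ 1 = total_deriv dm q" by (simp add: One_nat_def)
    with Cons show ?case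
      by (cases "r = q") (simp_all add: pow axis_nth_nat funpow_add)
  qed simp
  from this[of "sorted_list_of_set UNIV"] show ?thesis
    by (simp add: total_derivs_def)
qed

text \<open>Builds a multi-index by single units, each of which contributes a single
  \<partial>_r.\<close>

lemma vec_nat_induct [case_names zero add_axis]:
  fixes n :: "(nat, 'i::finite) vec"
  assumes "P 0" and step: "\<And>n r. P n \<Longrightarrow> P (n + axis r 1)"
  shows "P n"
proof (induction "\<Sum>r\<in>UNIV. n $ r" arbitrary: n rule: less_induct)
  case less
  show ?case
  proof (cases "n = 0")
    case False
    then obtain r where "n $ r \<noteq> 0" by (auto simp: vec_eq_iff)
    then have r: "n $ r \<ge> 1" by simp
    then have n: "n = n - axis r 1 + axis r 1"
      by (simp add: le_diff_add_vec axis_le_iff)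
    have "(\<Sum>q\<in>UNIV. (n - axis r 1) $ q) < (\<Sum>q\<in>UNIV. n $ q)"
      using r by (intro sum_strict_mono_ex1) (auto simp: axis_nth_nat intro!: bexI[of _ r])
    then show ?thesis using less step n by metis
  qed (use assms in simp)
qed

lemma linear_total_derivs: "linear (total_derivs dm k)"
proof (induction k rule: vec_nat_induct)
  case zero
  show ?case by (simp add: linear_iff)
next
  case (add_axis n r)
  have "total_derivs dm (n + axis r 1) = total_deriv dm r \<circ> total_derivs dm n"
    by (auto simp: total_derivs_add_axis)
  then show ?case using linear_compose[OF add_axis linear_total_deriv] by (simp only:)
qed

section \<open>Binomial coefficients of multi-indices and moving D_a past \<partial>^n\<close>

lemma finite_atMost_vec [simp]: "finite {..n :: (nat, 'i::finite) vec}"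
proof (rule finite_imageD)
  have "vec_nth ` {..n} \<subseteq> (\<Pi>\<^sub>E r\<in>UNIV. {..n $ r})"
    by (auto simp: less_eq_vec_def)
  then show "finite (vec_nth ` {..n})"
    by (rule finite_subset) (auto intro: finite_PiE)
qed (simp add: inj_on_def vec_nth_inject)

text \<open>The value 0 outside \<open>m \<le> n\<close> lets sums over \<open>m\<close> be bounded
  by the edge decoration alone.\<close>

definition mbinom :: "(nat, 'i::finite) vec \<Rightarrow> (nat, 'i) vec \<Rightarrow> real"
  where "mbinom n m = (\<Prod>r\<in>UNIV. real (n $ r choose m $ r))"

lemma mbinom_eq_0: "\<not> m \<le> n \<Longrightarrow> mbinom n m = 0"
  by (force simp: mbinom_def less_eq_vec_def not_le)

lemma mbinom_eq_mfact:
  assumes "m \<le> n"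
  shows "mbinom n m = mfact n / (mfact (n - m) * mfact m)"
  using assms unfolding mbinom_def mfact_def prod.distrib[symmetric] prod_dividef[symmetric]
  by (intro prod.cong refl) (simp add: less_eq_vec_def binomial_fact mult.commute)

lemma mbinom_0_left: "mbinom 0 m = (if m = 0 then 1 else 0)"
proof (cases "m = 0")
  case False
  then have "\<not> m \<le> 0" by (force simp: vec_eq_iff less_eq_vec_def)
  with False show ?thesis by (simp add: mbinom_eq_0)
qed (simp add: mbinom_def)

text \<open>Pascal's rule in coordinate \<open>r\<close>, the other factors being unchanged. The
  guard removes the term that truncated subtraction would leave for
  \<open>m $ r = 0\<close>.\<close>

lemma mbinom_add_axis:
  "mbinom (n + axis r 1) m = mbinom n m + (if axis r 1 \<le> m then mbinom n (m - axis r 1) else 0)"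
proof -
  let ?P = "\<Prod>q\<in>UNIV - {r}. real (n $ q choose m $ q)"
  have split: "(\<Prod>q\<in>UNIV. f q) = f r * (\<Prod>q\<in>UNIV - {r}. f q)" for f :: "'a \<Rightarrow> real"
    by (rule prod.remove) auto
  have "mbinom (n + axis r 1) m = real (n $ r + 1 choose m $ r) * ?P"
    unfolding mbinom_def split by (simp add: axis_nth_nat)
  moreover have "mbinom n m = real (n $ r choose m $ r) * ?P"
    unfolding mbinom_def split ..
  moreover have "mbinom n (m - axis r 1) = real (n $ r choose (m $ r - 1)) * ?P"
    unfolding mbinom_def split by (simp add: axis_nth_nat)
  moreover have "real (n $ r + 1 choose m $ r) = real (n $ r choose m $ r)
      + (if m $ r \<ge> 1 then real (n $ r choose (m $ r - 1)) else 0)"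
    by (cases "m $ r") (simp_all add: One_nat_def)
  ultimately show ?thesis
    by (simp add: axis_le_iff algebra_simps)
qed

text \<open>Iterates \<open>[D\<^bsub>(t,p)\<^esub>, \<partial>\<^sub>r] = D\<^bsub>(t,p - e\<^sub>r)\<^esub>\<close>. This is the source of the shifts \<open>a\<^sub>i - m\<^sub>i\<close> and of the
  multinomial coefficients in the product \<open>\<star>\<close>.\<close>

lemma partial_total_derivs:
  fixes p :: "(nat, 'i::{finite,linorder}) vec"
  assumes "c < dm t"
  shows "partial ((t, p), c) (total_derivs dm n f)
    = (\<Sum>m\<in>{..p}. mbinom n m *\<^sub>R total_derivs dm (n - m) (partial ((t, p - m), c) f))"
proof (induction n arbitrary: p rule: vec_nat_induct)
  case zero
  have "(\<Sum>m\<in>{..p}. mbinom 0 m *\<^sub>R total_derivs dm (0 - m) (partial ((t, p - m), c) f))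
      = (\<Sum>m\<in>{..p}. if m = 0 then partial ((t, p), c) f else 0)"
    by (intro sum.cong) (auto simp: mbinom_0_left)
  also have "\<dots> = partial ((t, p), c) f"
    by (simp add: less_eq_vec_def)
  finally show ?case by simp
next
  case (add_axis n r)
  let ?T = "total_derivs dm" and ?D = "\<lambda>p. partial ((t, p), c)"
  \<comment> \<open>The two truncated differences agree only for \<open>m \<le> n\<close>; otherwise
    the coefficient vanishes.\<close>
  have 1: "mbinom n m *\<^sub>R total_deriv dm r (?T (n - m) (?D (p - m) f))
      = mbinom n m *\<^sub>R ?T (n + axis r 1 - m) (?D (p - m) f)" for m
  proof (cases "m \<le> n")
    case True
    then have "n + axis r 1 - m = n - m + axis r 1"
      by (simp add: vec_eq_iff less_eq_vec_def)
    then show ?thesis by (simp add: total_derivs_add_axis)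
  qed (simp add: mbinom_eq_0)
  \<comment> \<open>The commutator term is the induction hypothesis at \<open>p - axis r 1\<close>.
    After the substitution of \<open>m + axis r 1\<close> for \<open>m\<close> it carries the second
    summand of Pascal's rule.\<close>
  have 2: "(if axis r 1 \<le> p then ?D (p - axis r 1) (?T n f) else 0)
      = (\<Sum>m\<in>{..p}. (if axis r 1 \<le> m then mbinom n (m - axis r 1) else 0)
          *\<^sub>R ?T (n + axis r 1 - m) (?D (p - m) f))"
  proof (cases "axis r 1 \<le> p")
    case True
    have "?D (p - axis r 1) (?T n f) = (\<Sum>m\<in>{..p - axis r 1}.
        mbinom n m *\<^sub>R ?T (n - m) (?D (p - axis r 1 - m) f))"
      by (rule add_axis)
    also have "\<dots> = (\<Sum>m\<in>{m \<in> {..p}. axis r 1 \<le> m}.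
        mbinom n (m - axis r 1) *\<^sub>R ?T (n + axis r 1 - m) (?D (p - m) f))"
    proof (rule sum.reindex_bij_witness[where i = "\<lambda>m. m - axis r 1" and j = "\<lambda>m. m + axis r 1"])
      fix m :: "(nat, 'i) vec" assume m: "m \<in> {..p - axis r 1}"
      show "m + axis r 1 - axis r 1 = m" by simp
      show "m + axis r 1 \<in> {m \<in> {..p}. axis r 1 \<le> m}"
        using m True by (auto simp: less_eq_vec_def le_diff_conv2)
      have "n + axis r 1 - (m + axis r 1) = n - m" "p - (m + axis r 1) = p - axis r 1 - m"
        by (auto simp: vec_eq_iff)
      then show "mbinom n (m + axis r 1 - axis r 1) *\<^sub>R ?T (n + axis r 1 - (m + axis r 1))
          (?D (p - (m + axis r 1)) f) = mbinom n m *\<^sub>R ?T (n - m) (?D (p - axis r 1 - m) f)"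
        by simp
    next
      fix m :: "(nat, 'i) vec" assume m: "m \<in> {m \<in> {..p}. axis r 1 \<le> m}"
      then show "m - axis r 1 + axis r 1 = m" by (simp add: le_diff_add_vec)
      show "m - axis r 1 \<in> {..p - axis r 1}"
        using m by (auto simp: less_eq_vec_def diff_le_mono)
    qed
    also have "\<dots> = (\<Sum>m\<in>{..p}. if axis r 1 \<le> m then
        mbinom n (m - axis r 1) *\<^sub>R ?T (n + axis r 1 - m) (?D (p - m) f) else 0)"
      by (rule sum.inter_filter) simp
    finally show ?thesis using True by (simp add: if_distrib[of "\<lambda>x. x *\<^sub>R _"] cong: if_cong)
  next
    case False
    then have "\<not> axis r 1 \<le> m" if "m \<le> p" for m using that order_trans by blast
    with False show ?thesis by simp
  qed
  have "?D p (?T (n + axis r 1) f)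
      = total_deriv dm r (?D p (?T n f)) + (if axis r 1 \<le> p then ?D (p - axis r 1) (?T n f) else 0)"
    unfolding total_derivs_add_axis by (rule partial_total_deriv) (rule assms)
  also have "total_deriv dm r (?D p (?T n f))
      = (\<Sum>m\<in>{..p}. mbinom n m *\<^sub>R ?T (n + axis r 1 - m) (?D (p - m) f))"
    unfolding add_axis linear_sum[OF linear_total_deriv] o_def
    by (simp add: linear_scale[OF linear_total_deriv] 1)
  finally show ?case
    unfolding 2 by (simp add: mbinom_add_axis scaleR_left_distrib sum.distrib)
qed


section \<open>Elementary differentials as sums over components\<close>

text \<open>Lifts a listing of branches to a listing of their indices: \<open>elem_diff\<close>
  works with lists, the argument with finite index sets.\<close>

lemma image_mset_eq_mset_imp:
  assumes "mset xs = image_mset \<phi> M"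
  obtains ys where "mset ys = M" "map \<phi> ys = xs"
  using assms
proof (induction xs arbitrary: M thesis)
  case (Cons x xs)
  from Cons.prems(2) have "add_mset x (mset xs) = image_mset \<phi> M" by simp
  then obtain y N where yN: "M = add_mset y N" "\<phi> y = x" "mset xs = image_mset \<phi> N"
    by (metis msed_map_invR)
  obtain ys where "mset ys = N" "map \<phi> ys = xs" using Cons.IH[OF _ yN(3)] by blast
  with yN show ?case by (intro Cons.prems(1)[of "y # ys"]) auto
qed simp

lemma sum_PiE_reindex:
  assumes g: "bij_betw g A B"
  shows "(\<Sum>c\<in>Pi\<^sub>E A (\<lambda>a. T (g a)). F c) = (\<Sum>c\<in>Pi\<^sub>E B T. F (\<lambda>a\<in>A. c (g a)))"
proof (rule sum.reindex_bij_witness[where j = "\<lambda>c. \<lambda>b\<in>B. c (inv_into A g b)"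
      and i = "\<lambda>c. \<lambda>a\<in>A. c (g a)"])
  have inv: "inv_into A g (g a) = a" if "a \<in> A" for a
    using g that by (simp add: bij_betw_inv_into_left)
  have inv': "g (inv_into A g b) = b" "inv_into A g b \<in> A" if "b \<in> B" for b
    using g that by (auto simp: bij_betw_inv_into_right bij_betw_def inv_into_into)
  have gB: "g a \<in> B" if "a \<in> A" for a using g that by (auto simp: bij_betw_def)
  fix c assume c: "c \<in> Pi\<^sub>E A (\<lambda>a. T (g a))"
  show *: "(\<lambda>a\<in>A. (\<lambda>b\<in>B. c (inv_into A g b)) (g a)) = c"
    by (subst (2) PiE_restrict[OF c, symmetric], rule restrict_ext) (simp add: inv gB)
  show "(\<lambda>b\<in>B. c (inv_into A g b)) \<in> Pi\<^sub>E B T"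
    using c inv' by (fastforce simp: PiE_iff)
  show "F (\<lambda>a\<in>A. (\<lambda>b\<in>B. c (inv_into A g b)) (g a)) = F c" unfolding * ..
next
  have inv': "g (inv_into A g b) = b" "inv_into A g b \<in> A" if "b \<in> B" for b
    using g that by (auto simp: bij_betw_inv_into_right bij_betw_def inv_into_into)
  have gB: "g a \<in> B" if "a \<in> A" for a using g that by (auto simp: bij_betw_def)
  fix c assume c: "c \<in> Pi\<^sub>E B T"
  show "(\<lambda>b\<in>B. (\<lambda>a\<in>A. c (g a)) (inv_into A g b)) = c"
    by (subst (2) PiE_restrict[OF c, symmetric], rule restrict_ext) (simp add: inv')
  show "(\<lambda>a\<in>A. c (g a)) \<in> Pi\<^sub>E A (\<lambda>a. T (g a))"
    using c gB by (auto simp: PiE_iff)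
qed

lemma sum_PiE_Plus:
  assumes "finite A" "finite B"
  shows "(\<Sum>c\<in>Pi\<^sub>E (A <+> B) T. F c) = (\<Sum>e\<in>Pi\<^sub>E B (\<lambda>b. T (Inr b)). \<Sum>d\<in>Pi\<^sub>E A (\<lambda>a. T (Inl a)).
    F (\<lambda>x\<in>A <+> B. case x of Inl a \<Rightarrow> d a | Inr b \<Rightarrow> e b))"
  unfolding sum.cartesian_product
proof (rule sum.reindex_bij_witness[where j = "\<lambda>c. (\<lambda>b\<in>B. c (Inr b), \<lambda>a\<in>A. c (Inl a))"
      and i = "\<lambda>(e, d). \<lambda>x\<in>A <+> B. case x of Inl a \<Rightarrow> d a | Inr b \<Rightarrow> e b"])
  fix c assume c: "c \<in> Pi\<^sub>E (A <+> B) T"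
  have "(\<lambda>x\<in>A <+> B. case x of Inl a \<Rightarrow> (\<lambda>a\<in>A. c (Inl a)) a
      | Inr b \<Rightarrow> (\<lambda>b\<in>B. c (Inr b)) b) = c"
    by (rule trans[OF restrict_ext PiE_restrict[OF c]]) (auto split: sum.split)
  then show "(case (\<lambda>b\<in>B. c (Inr b), \<lambda>a\<in>A. c (Inl a)) of
        (e, d) \<Rightarrow> \<lambda>x\<in>A <+> B. case x of Inl a \<Rightarrow> d a | Inr b \<Rightarrow> e b) = c"
    and "(case (\<lambda>b\<in>B. c (Inr b), \<lambda>a\<in>A. c (Inl a)) of
        (e, d) \<Rightarrow> F (\<lambda>x\<in>A <+> B. case x of Inl a \<Rightarrow> d a | Inr b \<Rightarrow> e b)) = F c"
    by simp_all
  show "(\<lambda>b\<in>B. c (Inr b), \<lambda>a\<in>A. c (Inl a))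
      \<in> Pi\<^sub>E B (\<lambda>b. T (Inr b)) \<times> Pi\<^sub>E A (\<lambda>a. T (Inl a))"
    using c by (auto simp: PiE_iff)
qed (auto simp: PiE_iff fun_eq_iff extensional_def split: sum.split)

text \<open>The order-free counterpart of \<open>diff_prod\<close>: any finite set can index the
  directions, in particular branch occurrences or a disjoint sum of old and new branches.\<close>

definition directional ::
  "('o \<Rightarrow> nat) \<Rightarrow> (nat, 'i::{finite,linorder}) vec \<Rightarrow> 'x set \<Rightarrow> ('x \<Rightarrow> ('i, 'o) edge)
    \<Rightarrow> ('x \<Rightarrow> nat \<Rightarrow> ('i, 'o) var sfield) \<Rightarrow> ('i, 'o) var sfield \<Rightarrow> ('i, 'o) var sfield"
  where "directional dm k J a h f = (\<Sum>c\<in>(\<Pi>\<^sub>E j\<in>J. {..<dm (fst (a j))}).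
    (\<Prod>j\<in>J. h j (c j)) * total_derivs dm k (partials {#(a j, c j). j \<in># mset_set J#} f))"

lemma linear_directional: "linear (directional dm k J a h)"
  unfolding directional_def
  by (intro linear_compose_sum ballI linear_compose[OF _ linear_compose[OF linear_partials
        linear_total_derivs], unfolded o_def] linearI)
    (simp_all add: linear_add[OF linear_total_derivs] linear_add[OF linear_partials]
      linear_scale[OF linear_total_derivs] linear_scale[OF linear_partials] distrib_left)

lemma image_mset_mset_set_cong:
  "(\<And>x. x \<in> A \<Longrightarrow> f x = g x) \<Longrightarrow> image_mset f (mset_set A) = image_mset g (mset_set A)"
  by (cases "finite A") (auto intro: image_mset_cong)

text \<open>The bridge from plain functions to the algebra. As the right side mentions no order, any
  two listings of the same branches give the same \<open>diff_prod\<close>. The functions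
  \<open>H\<close> have to match only for components below the dimension, where smoothness is
  known.\<close>

lemma apply_directional:
  fixes J :: "'x set"
  assumes "finite J" and xs: "mset xs = image_mset \<phi> (mset_set J)"
    and H: "\<And>x c. x \<in> set xs \<Longrightarrow> c < dm (fst (fst x)) \<Longrightarrow> H x c = apply_sfield (h x c)"
  shows "diff_prod dm k (map (\<lambda>x. (fst x, H x)) xs) (apply_sfield f)
    = apply_sfield (directional dm k J (\<lambda>j. fst (\<phi> j)) (\<lambda>j. h (\<phi> j)) f)"
proof
  fix Z
  obtain ys where ys: "mset ys = mset_set J" "map \<phi> ys = xs"
    using image_mset_eq_mset_imp[OF xs] .
  have len: "length xs = length ys" and nth: "\<And>j. j < length ys \<Longrightarrow> xs ! j = \<phi> (ys ! j)"
    using ys by auto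
  have "distinct ys" "set ys = J"
    using ys \<open>finite J\<close> by (metis count_mset_set(1,3) distinct_count_atmost_1 finite_set_mset_mset_set set_mset_mset)+
  then have bij: "bij_betw ((!) ys) {..<length ys} J"
    by (auto intro: bij_betw_nth)
  have mset_nth: "image_mset ((!) ys) (mset [0..<length ys]) = mset_set J"
    unfolding ys(1)[symmetric] mset_map[symmetric] map_nth ..
  let ?n = "length ys"
  have "diff_prod dm k (map (\<lambda>x. (fst x, H x)) xs) (apply_sfield f) Z
      = (\<Sum>c\<in>(\<Pi>\<^sub>E j\<in>{..<?n}. {..<dm (fst (fst (\<phi> (ys ! j))))}).
          tderivs dm k (foldr pdiff (map (\<lambda>j. (fst (\<phi> (ys ! j)), c j)) [0..<?n]) (apply_sfield f)) Z
          * (\<Prod>j<?n. apply_sfield (h (\<phi> (ys ! j)) (c j)) Z))"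
  proof -
    have PiE: "(\<Pi>\<^sub>E j\<in>{..<length (map (\<lambda>x. (fst x, H x)) xs)}.
        {..<dm (fst (fst (map (\<lambda>x. (fst x, H x)) xs ! j)))})
        = (\<Pi>\<^sub>E j\<in>{..<?n}. {..<dm (fst (fst (\<phi> (ys ! j))))})"
      unfolding length_map len by (intro PiE_cong) (simp add: len nth)
    show ?thesis
      unfolding diff_prod_def PiE
    proof (intro sum.cong refl arg_cong2[of _ _ _ _ "(*)"] prod.cong)
      fix c :: "nat \<Rightarrow> nat" assume "c \<in> (\<Pi>\<^sub>E j\<in>{..<?n}. {..<dm (fst (fst (\<phi> (ys ! j))))})"
      then have c: "c j < dm (fst (fst (\<phi> (ys ! j))))" if "j < ?n" for j
        using that by (auto simp: PiE_iff)
      have "foldr (\<lambda>j. pdiff (fst (map (\<lambda>x. (fst x, H x)) xs ! j), c j)) [0..<length (map (\<lambda>x. (fst x, H x)) xs)] (apply_sfield f)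
        = foldr (\<lambda>j. pdiff (fst (\<phi> (ys ! j)), c j)) [0..<?n] (apply_sfield f)"
        by (intro foldr_cong) (auto simp: len nth)
      then show "tderivs dm k (foldr (\<lambda>j. pdiff (fst (map (\<lambda>x. (fst x, H x)) xs ! j), c j))
            [0..<length (map (\<lambda>x. (fst x, H x)) xs)] (apply_sfield f)) Z
        = tderivs dm k (foldr pdiff (map (\<lambda>j. (fst (\<phi> (ys ! j)), c j)) [0..<?n]) (apply_sfield f)) Z"
        by (simp add: foldr_map o_def)
      show "{..<length (map (\<lambda>x. (fst x, H x)) xs)} = {..<?n}" by (simp add: len)
      fix j assume "j \<in> {..<?n}"
      then show "snd (map (\<lambda>x. (fst x, H x)) xs ! j) (c j) Z = apply_sfield (h (\<phi> (ys ! j)) (c j)) Z"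
        using H[of "\<phi> (ys ! j)" "c j"] c[of j] ys(2) by (auto simp: len nth)
    qed
  qed
  also have "\<dots> = (\<Sum>c\<in>(\<Pi>\<^sub>E j\<in>J. {..<dm (fst (fst (\<phi> j)))}).
          tderivs dm k (foldr pdiff (map (\<lambda>j. (fst (\<phi> (ys ! j)), (\<lambda>j\<in>{..<?n}. c (ys ! j)) j)) [0..<?n])
            (apply_sfield f)) Z
          * (\<Prod>j<?n. apply_sfield (h (\<phi> (ys ! j)) ((\<lambda>j\<in>{..<?n}. c (ys ! j)) j)) Z))"
    by (rule sum_PiE_reindex[OF bij])
  also have "\<dots> = (\<Sum>c\<in>(\<Pi>\<^sub>E j\<in>J. {..<dm (fst (fst (\<phi> j)))}).
          (\<Prod>j\<in>J. apply_sfield (h (\<phi> j) (c j)) Z)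
          * apply_sfield (total_derivs dm k (partials {#(fst (\<phi> j), c j). j \<in># mset_set J#} f)) Z)"
  proof (intro sum.cong refl)
    fix c :: "'x \<Rightarrow> nat"
    have "mset (map (\<lambda>j. (fst (\<phi> (ys ! j)), (\<lambda>j\<in>{..<?n}. c (ys ! j)) j)) [0..<?n])
        = image_mset (\<lambda>j. (fst (\<phi> j), c j)) (image_mset ((!) ys) (mset [0..<?n]))"
      by (auto simp: image_mset.compositionality o_def intro!: image_mset_cong)
    moreover have "(\<Prod>j<?n. apply_sfield (h (\<phi> (ys ! j)) ((\<lambda>j\<in>{..<?n}. c (ys ! j)) j)) Z)
        = (\<Prod>j\<in>J. apply_sfield (h (\<phi> j) (c j)) Z)"
      unfolding prod.reindex_bij_betw[OF bij, symmetric] by (intro prod.cong) auto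
    ultimately show "tderivs dm k (foldr pdiff (map (\<lambda>j. (fst (\<phi> (ys ! j)), (\<lambda>j\<in>{..<?n}. c (ys ! j)) j)) [0..<?n])
            (apply_sfield f)) Z
          * (\<Prod>j<?n. apply_sfield (h (\<phi> (ys ! j)) ((\<lambda>j\<in>{..<?n}. c (ys ! j)) j)) Z)
        = (\<Prod>j\<in>J. apply_sfield (h (\<phi> j) (c j)) Z)
          * apply_sfield (total_derivs dm k (partials {#(fst (\<phi> j), c j). j \<in># mset_set J#} f)) Z"
      by (simp only: apply_partials_mset[symmetric] apply_total_derivs[symmetric] mset_nth mult.commute)
  qed
  finally show "diff_prod dm k (map (\<lambda>x. (fst x, H x)) xs) (apply_sfield f) Z
    = apply_sfield (directional dm k J (\<lambda>j. fst (\<phi> j)) (\<lambda>j. h (\<phi> j)) f) Z"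
    by (simp add: directional_def apply_sfield_sum apply_sfield_prod times_sfield.rep_eq)
qed

lemma mset_set_Plus:
  assumes "finite A" "finite B"
  shows "mset_set (A <+> B) = image_mset Inl (mset_set A) + image_mset Inr (mset_set B)"
proof -
  have "Inl ` A \<inter> Inr ` B = {}" by auto
  then show ?thesis
    using assms by (simp add: Plus_def mset_set_Union image_mset_mset_set)
qed

text \<open>Meant for \<open>A\<close> the branches newly grafted to a node and \<open>B\<close> its
  original ones: the latter stay with the function at the node, the former become an operator acting
  on it.\<close>

lemma directional_Plus:
  fixes A :: "'x set" and B :: "'y set"
  assumes "finite A" "finite B"
  shows "directional dm k (A <+> B) a h f = (\<Sum>e\<in>(\<Pi>\<^sub>E b\<in>B. {..<dm (fst (a (Inr b)))}).
    (\<Prod>b\<in>B. h (Inr b) (e b)) * directional dm k A (\<lambda>x. a (Inl x)) (\<lambda>x. h (Inl x))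
      (partials {#(a (Inr b), e b). b \<in># mset_set B#} f))"
  unfolding directional_def sum_PiE_Plus[OF assms] sum_distrib_left
proof (intro sum.cong refl)
  fix e :: "'y \<Rightarrow> nat" and d :: "'x \<Rightarrow> nat"
  let ?c = "\<lambda>x\<in>A <+> B. case x of Inl a \<Rightarrow> d a | Inr b \<Rightarrow> e b"
  have "{#(a j, ?c j). j \<in># mset_set (A <+> B)#}
      = {#(a (Inl x), d x). x \<in># mset_set A#} + {#(a (Inr b), e b). b \<in># mset_set B#}"
    unfolding mset_set_Plus[OF assms] image_mset_union image_mset.compositionality
    by (intro arg_cong2[of _ _ _ _ "(+)"] image_mset_mset_set_cong) auto
  moreover have "(\<Prod>j\<in>A <+> B. h j (?c j)) = (\<Prod>x\<in>A. h (Inl x) (d x)) * (\<Prod>b\<in>B. h (Inr b) (e b))"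
    using assms by (simp add: prod.Plus o_def)
  ultimately show "(\<Prod>j\<in>A <+> B. h j (?c j))
      * total_derivs dm k (partials {#(a j, ?c j). j \<in># mset_set (A <+> B)#} f)
    = (\<Prod>b\<in>B. h (Inr b) (e b)) * ((\<Prod>x\<in>A. h (Inl x) (d x))
      * total_derivs dm k (partials {#(a (Inl x), d x). x \<in># mset_set A#}
          (partials {#(a (Inr b), e b). b \<in># mset_set B#} f)))"
    by (simp only: partials_union mult_ac)
qed

lemma image_mset_fst_occs: "image_mset fst (mset_set (occs M)) = M"
proof (rule multiset_eqI)
  fix x
  have "count (image_mset fst (mset_set (occs M))) x = card {y \<in> occs M. fst y = x}"
    by (simp add: count_image_mset vimage_def Int_def conj_commute sum.If_cases)
  also have "{y \<in> occs M. fst y = x} = Pair x ` {..<count M x}"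
    by (auto simp: occs_def count_inI)
  also have "card \<dots> = count M x"
    by (simp add: card_image inj_on_def)
  finally show "count (image_mset fst (mset_set (occs M))) x = count M x" .
qed


section \<open>Derivations acting on elementary differentials\<close>

text \<open>\<open>node_prod\<close> is the elementary differential of a tree with an operator \<open>P u\<close> in place of
  \<open>\<partial>\<^bsup>\<nn>\<^sub>u\<^esup>\<close> at each node \<open>u\<close>. It is linear in each \<open>P u\<close>, and a derivation acts on it by the
  Leibniz rule over the nodes.\<close>

function node_prod ::
  "('o \<Rightarrow> nat) \<Rightarrow> ('o \<Rightarrow> 'n option \<Rightarrow> nat \<Rightarrow> ('i, 'o) var sfield)
    \<Rightarrow> (('i, 'n, 'o) occ list \<Rightarrow> ('i, 'o) var sfield \<Rightarrow> ('i, 'o) var sfield)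
    \<Rightarrow> ('i::finite, 'n, 'o) dtree \<Rightarrow> 'o \<Rightarrow> nat \<Rightarrow> ('i, 'o) var sfield"
  where "node_prod dm G P (Node k l C) = (\<lambda>i c.
    \<Sum>e\<in>(\<Pi>\<^sub>E y\<in>occs C. {..<dm (fst (fst (fst y)))}).
      (\<Prod>y\<in>occs C. node_prod dm G (\<lambda>u. P (y # u)) (snd (fst y)) (fst (fst (fst y))) (e y))
      * P [] (partials {#(fst (fst y), e y). y \<in># mset_set (occs C)#} (G i l c)))"
  by pat_completeness auto
termination
  by (relation "Wellfounded.measure (\<lambda>(dm, G, P, \<tau>). size \<tau>)")
    (auto intro: size_branch simp: occs_def simp del: dtree.size)

lemma finite_nodes [simp]: "finite (nodes \<tau>)"
  by (induction \<tau> rule: nodes.induct) auto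

lemma sum_nodes:
  "(\<Sum>u\<in>nodes (Node k l C). g u) = g [] + (\<Sum>y\<in>occs C. \<Sum>u\<in>nodes (snd (fst y)). g (y # u))"
proof -
  have reindex: "(\<Sum>u\<in>Cons y ` N. g u) = (\<Sum>u\<in>N. g (y # u))" for y N
    by (simp add: sum.reindex)
  have "(\<Sum>u\<in>(\<Union>y\<in>occs C. Cons y ` nodes (snd (fst y))). g u)
      = (\<Sum>y\<in>occs C. \<Sum>u\<in>Cons y ` nodes (snd (fst y)). g u)"
    by (rule sum.UNION_disjoint) auto
  also have "\<dots> = (\<Sum>y\<in>occs C. \<Sum>u\<in>nodes (snd (fst y)). g (y # u))"
    unfolding reindex ..
  finally have 1: "(\<Sum>u\<in>(\<Union>y\<in>occs C. Cons y ` nodes (snd (fst y))). g u)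
      = (\<Sum>y\<in>occs C. \<Sum>u\<in>nodes (snd (fst y)). g (y # u))" .
  have "[] \<notin> (\<Union>y\<in>occs C. Cons y ` nodes (snd (fst y)))" by auto
  then show ?thesis
    unfolding nodes.simps by (subst sum.insert) (use 1 in auto)
qed

lemma upd_Cons_Cons: "(\<lambda>v. (P(y # u := q)) (y' # v)) = (if y' = y then (\<lambda>v. P (y # v))(u := q) else (\<lambda>v. P (y' # v)))"
  by (auto simp: fun_eq_iff)

text \<open>Linearity in the operator at the single node \<open>u\<close>, over the ring and not
  only over the reals: as \<open>g x\<close> one can take a component of some F(\<tau>_j). The
  induction follows the path from the root to \<open>u\<close>.\<close>

lemma node_prod_sum:
  assumes "u \<in> nodes \<tau>" "P u = (\<lambda>f. \<Sum>x\<in>X. g x * Q x f)"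
  shows "node_prod dm G P \<tau> i c = (\<Sum>x\<in>X. g x * node_prod dm G (P(u := Q x)) \<tau> i c)"
  using assms
proof (induction \<tau> arbitrary: u P i c rule: nodes.induct)
  case (1 k l C)
  let ?E = "\<Pi>\<^sub>E y\<in>occs C. {..<dm (fst (fst (fst y)))}"
  let ?f = "\<lambda>e. partials {#(fst (fst y), e y). y \<in># mset_set (occs C)#} (G i l c)"
  let ?N = "\<lambda>P y. node_prod dm G P (snd (fst y)) (fst (fst (fst y)))"
  show ?case
  proof (cases u)
    case Nil
    have "node_prod dm G P (Node k l C) i c
        = (\<Sum>e\<in>?E. \<Sum>x\<in>X. g x * ((\<Prod>y\<in>occs C. ?N (\<lambda>u. P (y # u)) y (e y)) * Q x (?f e)))"
      using "1.prems"(2) Nil by (simp add: sum_distrib_left mult_ac)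
    also have "\<dots> = (\<Sum>x\<in>X. \<Sum>e\<in>?E. g x * ((\<Prod>y\<in>occs C. ?N (\<lambda>u. P (y # u)) y (e y)) * Q x (?f e)))"
      by (rule sum.swap)
    finally show ?thesis by (simp add: Nil sum_distrib_left)
  next
    case (Cons y u')
    with "1.prems"(1) have y: "y \<in> occs C" and u': "u' \<in> nodes (snd (fst y))" by auto
    have step: "?N (\<lambda>v. P (y # v)) y d = (\<Sum>x\<in>X. g x * ?N ((\<lambda>v. P (y # v))(u' := Q x)) y d)" for d
      by (rule "1.IH"[OF y u']) (use "1.prems"(2) Cons in simp)
    have prod: "(\<Prod>y'\<in>occs C. ?N (\<lambda>v. (P(u := Q x)) (y' # v)) y' (e y'))
        = ?N ((\<lambda>v. P (y # v))(u' := Q x)) y (e y) * (\<Prod>y'\<in>occs C - {y}. ?N (\<lambda>v. P (y' # v)) y' (e y'))"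
      for e x
      unfolding Cons upd_Cons_Cons prod.remove[OF finite_occs y] by (auto intro!: prod.cong)
    have "node_prod dm G P (Node k l C) i c = (\<Sum>e\<in>?E. \<Sum>x\<in>X. g x *
        ((\<Prod>y'\<in>occs C. ?N (\<lambda>v. (P(u := Q x)) (y' # v)) y' (e y')) * P [] (?f e)))"
      unfolding prod node_prod.simps prod.remove[OF finite_occs y] step
      by (simp add: sum_distrib_left sum_distrib_right mult_ac)
    also have "\<dots> = (\<Sum>x\<in>X. \<Sum>e\<in>?E. g x *
        ((\<Prod>y'\<in>occs C. ?N (\<lambda>v. (P(u := Q x)) (y' # v)) y' (e y')) * P [] (?f e)))"
      by (rule sum.swap)
    finally show ?thesis
      unfolding node_prod.simps sum_distrib_left by (simp add: Cons)
  qed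
qed

text \<open>A derivation falls either on the factor at the root or on one of the branches, to which
  the induction hypothesis applies. Composing it with \<open>P u\<close> stays within the form
  \<open>node_prod\<close> because \<open>P\<close> is arbitrary.\<close>

lemma derivation_node_prod:
  assumes d: "derivation d"
  shows "d (node_prod dm G P \<tau> i c)
    = (\<Sum>u\<in>nodes \<tau>. node_prod dm G (P(u := (\<lambda>f. d (P u f)))) \<tau> i c)"
proof (induction \<tau> arbitrary: P i c rule: nodes.induct)
  case (1 k l C)
  let ?E = "\<Pi>\<^sub>E y\<in>occs C. {..<dm (fst (fst (fst y)))}"
  let ?f = "\<lambda>e. partials {#(fst (fst y), e y). y \<in># mset_set (occs C)#} (G i l c)"
  let ?N = "\<lambda>P y. node_prod dm G P (snd (fst y)) (fst (fst (fst y)))"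
  let ?U = "\<lambda>u. P(u := (\<lambda>f. d (P u f)))"
  have root: "node_prod dm G (?U []) (Node k l C) i c
      = (\<Sum>e\<in>?E. (\<Prod>y\<in>occs C. ?N (\<lambda>v. P (y # v)) y (e y)) * d (P [] (?f e)))"
    by simp
  have branch: "node_prod dm G (?U (y # u)) (Node k l C) i c = (\<Sum>e\<in>?E.
      ?N ((\<lambda>v. P (y # v))(u := (\<lambda>f. d (P (y # u) f)))) y (e y)
      * (\<Prod>y'\<in>occs C - {y}. ?N (\<lambda>v. P (y' # v)) y' (e y')) * P [] (?f e))"
    if y: "y \<in> occs C" for y u
  proof -
    have "(\<Prod>y'\<in>occs C. ?N (\<lambda>v. (?U (y # u)) (y' # v)) y' (e y'))
        = ?N ((\<lambda>v. P (y # v))(u := (\<lambda>f. d (P (y # u) f)))) y (e y)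
          * (\<Prod>y'\<in>occs C - {y}. ?N (\<lambda>v. P (y' # v)) y' (e y'))" for e
      unfolding upd_Cons_Cons prod.remove[OF finite_occs y] by (auto intro!: prod.cong)
    then show ?thesis by simp
  qed
  have "d (node_prod dm G P (Node k l C) i c)
      = (\<Sum>e\<in>?E. (\<Prod>y\<in>occs C. ?N (\<lambda>v. P (y # v)) y (e y)) * d (P [] (?f e))
        + (\<Sum>y\<in>occs C. \<Sum>u\<in>nodes (snd (fst y)).
            ?N ((\<lambda>v. P (y # v))(u := (\<lambda>f. d (P (y # u) f)))) y (e y)
            * (\<Prod>y'\<in>occs C - {y}. ?N (\<lambda>v. P (y' # v)) y' (e y')) * P [] (?f e)))"
    unfolding node_prod.simps linear_sum[OF derivation_linear[OF d]] o_def
      derivation_mult[OF d] derivation_prod[OF d finite_occs]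
    by (intro sum.cong refl) (simp add: "1.IH" sum_distrib_right add.commute fun_upd_def)
  also have "\<dots> = node_prod dm G (?U []) (Node k l C) i c
      + (\<Sum>y\<in>occs C. \<Sum>u\<in>nodes (snd (fst y)). node_prod dm G (?U (y # u)) (Node k l C) i c)"
    unfolding sum.distrib root
  proof (intro arg_cong2[of _ _ _ _ "(+)"] refl)
    show "(\<Sum>e\<in>?E. \<Sum>y\<in>occs C. \<Sum>u\<in>nodes (snd (fst y)).
            ?N ((\<lambda>v. P (y # v))(u := (\<lambda>f. d (P (y # u) f)))) y (e y)
            * (\<Prod>y'\<in>occs C - {y}. ?N (\<lambda>v. P (y' # v)) y' (e y')) * P [] (?f e))
        = (\<Sum>y\<in>occs C. \<Sum>u\<in>nodes (snd (fst y)). node_prod dm G (?U (y # u)) (Node k l C) i c)"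
      by (subst sum.swap, intro sum.cong refl, subst sum.swap, intro sum.cong refl)
        (rule branch[symmetric])
  qed
  finally show ?case by (simp only: sum_nodes)
qed

section \<open>Elementary differentials of trees and of grafted trees in the algebra\<close>

definition elem_field ::
  "('o \<Rightarrow> nat) \<Rightarrow> ('o \<Rightarrow> 'n option \<Rightarrow> nat \<Rightarrow> ('i, 'o) var field)
    \<Rightarrow> ('i::{finite,linorder}, 'n, 'o) dtree \<Rightarrow> 'o \<Rightarrow> nat \<Rightarrow> ('i, 'o) var sfield"
  where "elem_field dm F \<tau> i c = Abs_sfield (elem_diff dm F \<tau> i c)"

text \<open>Normal form of the operators: at each node the D_a act before \<partial>^n. Here
  \<open>\<delta> u\<close> records the edges grafted at \<open>u\<close>, with chosen components,
  while the factors belonging to the grafted trees are kept elsewhere.\<close>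

abbreviation (input) decorated_prod ::
  "('o \<Rightarrow> nat) \<Rightarrow> ('o \<Rightarrow> 'n option \<Rightarrow> nat \<Rightarrow> ('i, 'o) var sfield)
    \<Rightarrow> (('i, 'n, 'o) occ list \<Rightarrow> (nat, 'i) vec) \<Rightarrow> (('i, 'n, 'o) occ list \<Rightarrow> ('i, 'o) var multiset)
    \<Rightarrow> ('i::{finite,linorder}, 'n, 'o) dtree \<Rightarrow> 'o \<Rightarrow> nat \<Rightarrow> ('i, 'o) var sfield"
  where "decorated_prod dm G \<nu> \<delta> \<equiv> node_prod dm G (\<lambda>u f. total_derivs dm (\<nu> u) (partials (\<delta> u) f))"

text \<open>\<open>G\<close> lifts \<open>F\<close> to the algebra, and is tied to it only at
  genuine components, where smoothness is known.\<close>

locale smooth_nonlinearity =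
  fixes dm :: "'o \<Rightarrow> nat"
    and F :: "'o \<Rightarrow> 'n option \<Rightarrow> nat \<Rightarrow> ('i::{finite,linorder}, 'o) var field"
    and G :: "'o \<Rightarrow> 'n option \<Rightarrow> nat \<Rightarrow> ('i, 'o) var sfield"
  assumes apply_G: "c < dm i \<Longrightarrow> apply_sfield (G i l c) = F i l c"
begin

text \<open>Makes \<open>Abs_sfield\<close> in \<open>elem_field\<close> faithful. The subtrees are
  reached through a listing chosen by \<open>SOME\<close>, whence the induction on the size.\<close>

lemma smooth_elem_diff: "c < dm i \<Longrightarrow> smooth_field (elem_diff dm F \<tau> i c)"
proof (induction \<tau> arbitrary: i c rule: measure_induct_rule[of size])
  case (less \<tau>)
  obtain k l C where \<tau>: "\<tau> = Node k l C" by (cases \<tau>)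
  define xs where "xs = (SOME xs. mset xs = C)"
  let ?H = "\<lambda>x. elem_diff dm F (snd x) (fst (fst x))"
  have "size (snd x) < size \<tau>" if "x \<in> set xs" for x
    using that size_branch[of x C k l] unfolding xs_def \<tau> by (simp add: set_some_mset del: dtree.size)
  then have "?H x c = apply_sfield (Abs_sfield (?H x c))" if "x \<in> set xs" "c < dm (fst (fst x))" for x c
    using less.IH that by (simp add: Abs_sfield_inverse)
  moreover have "mset xs = image_mset ((!) xs) (mset_set {..<length xs})"
    by (simp add: lessThan_atLeast0 flip: mset_upt mset_map) (simp add: map_nth)
  ultimately have "diff_prod dm k (map (\<lambda>x. (fst x, ?H x)) xs) (apply_sfield (G i l c))
      = apply_sfield (directional dm k {..<length xs} (\<lambda>j. fst (xs ! j))
        (\<lambda>j c. Abs_sfield (?H (xs ! j) c)) (G i l c))"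
    by (intro apply_directional) simp_all
  then have "elem_diff dm F \<tau> i c = apply_sfield (directional dm k {..<length xs} (\<lambda>j. fst (xs ! j))
        (\<lambda>j c. Abs_sfield (?H (xs ! j) c)) (G i l c))"
    using less.prems by (simp add: \<tau> apply_G xs_def)
  then show ?case by (simp add: smooth_apply_sfield)
qed

lemma apply_elem_field: "c < dm i \<Longrightarrow> apply_sfield (elem_field dm F \<tau> i c) = elem_diff dm F \<tau> i c"
  by (simp add: elem_field_def Abs_sfield_inverse smooth_elem_diff)

text \<open>The free choice of \<open>J\<close> is the point: a plain tree uses its branch
  occurrences, a grafted one a disjoint sum of new and old branches.\<close>

lemma elem_field_Node:
  assumes "finite J" "C = image_mset \<phi> (mset_set J)" "c < dm i"
  shows "elem_field dm F (Node k l C) i c = directional dm k J (\<lambda>j. fst (\<phi> j))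
    (\<lambda>j. elem_field dm F (snd (\<phi> j)) (fst (fst (\<phi> j)))) (G i l c)"
proof -
  have "mset (SOME xs. mset xs = C) = C" using ex_mset by (rule someI_ex)
  then have "diff_prod dm k (map (\<lambda>x. (fst x, elem_diff dm F (snd x) (fst (fst x))))
      (SOME xs. mset xs = C)) (apply_sfield (G i l c)) = apply_sfield (directional dm k J
      (\<lambda>j. fst (\<phi> j)) (\<lambda>j. elem_field dm F (snd (\<phi> j)) (fst (fst (\<phi> j)))) (G i l c))"
    using assms(2) apply_directional[OF \<open>finite J\<close>, of _ \<phi> dm
        "\<lambda>x. elem_diff dm F (snd x) (fst (fst x))" "\<lambda>x. elem_field dm F (snd x) (fst (fst x))"]
    by (simp add: apply_elem_field)
  then show ?thesis
    using assms(3) by (simp add: apply_elem_field apply_G flip: apply_sfield_inject)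
qed

lemma elem_field_eq_decorated_prod:
  "c < dm i \<Longrightarrow> elem_field dm F \<tau> i c = decorated_prod dm G (dec_at \<tau>) (\<lambda>u. {#}) \<tau> i c"
proof (induction \<tau> arbitrary: i c rule: nodes.induct)
  case (1 k l C)
  have "elem_field dm F (Node k l C) i c = directional dm k (occs C) (\<lambda>y. fst (fst y))
      (\<lambda>y. elem_field dm F (snd (fst y)) (fst (fst (fst y)))) (G i l c)"
    using 1 by (intro elem_field_Node) (auto simp: image_mset_fst_occs)
  also have "\<dots> = decorated_prod dm G (dec_at (Node k l C)) (\<lambda>u. {#}) (Node k l C) i c"
    by (auto simp: directional_def PiE_iff "1.IH" intro!: sum.cong prod.cong)
  finally show ?case .
qed

text \<open>Grafting leaves the shape of the original tree intact and only changes what happens at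
  each node, where the new branches act as further directional derivatives. So the differential of
  the grafted tree is still a product over the nodes of \<open>\<tau>\<close>.\<close>

lemma elem_field_modify:
  fixes J :: "('i, 'n, 'o) occ list \<Rightarrow> 'x set"
  assumes "\<And>u. finite (J u)" "\<And>u. \<gamma> u = image_mset \<phi> (mset_set (J u))" "c < dm i"
  shows "elem_field dm F (modify \<nu> \<gamma> \<tau>) i c = node_prod dm G
    (\<lambda>u. directional dm (\<nu> u) (J u) (\<lambda>j. fst (\<phi> j))
      (\<lambda>j. elem_field dm F (snd (\<phi> j)) (fst (fst (\<phi> j))))) \<tau> i c"
  using assms
proof (induction \<tau> arbitrary: \<nu> \<gamma> J i c rule: nodes.induct)
  case (1 k l C)
  let ?h = "\<lambda>j. elem_field dm F (snd (\<phi> j)) (fst (fst (\<phi> j)))"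
  let ?\<psi> = "\<lambda>y. (fst (fst y), modify (\<lambda>u. \<nu> (y # u)) (\<lambda>u. \<gamma> (y # u)) (snd (fst y)))"
  \<comment> \<open>Labels the branches at the new root: \<open>Inl\<close> for grafted ones,
    \<open>Inr\<close> for original ones with their modified subtrees.\<close>
  let ?\<chi> = "case_sum \<phi> ?\<psi>"
  have "elem_field dm F (modify \<nu> \<gamma> (Node k l C)) i c
      = directional dm (\<nu> []) (J [] <+> occs C) (\<lambda>j. fst (?\<chi> j))
        (\<lambda>j. elem_field dm F (snd (?\<chi> j)) (fst (fst (?\<chi> j)))) (G i l c)"
    unfolding modify.simps
    using "1.prems" by (intro elem_field_Node)
      (simp_all add: mset_set_Plus image_mset.compositionality o_def)
  also have "\<dots> = (\<Sum>e\<in>(\<Pi>\<^sub>E y\<in>occs C. {..<dm (fst (fst (fst y)))}).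
      (\<Prod>y\<in>occs C. elem_field dm F (snd (?\<psi> y)) (fst (fst (fst y))) (e y))
      * directional dm (\<nu> []) (J []) (\<lambda>j. fst (\<phi> j)) ?h
        (partials {#(fst (fst y), e y). y \<in># mset_set (occs C)#} (G i l c)))"
    using "1.prems" by (subst directional_Plus) auto
  also have "\<dots> = node_prod dm G (\<lambda>u. directional dm (\<nu> u) (J u) (\<lambda>j. fst (\<phi> j)) ?h) (Node k l C) i c"
    unfolding node_prod.simps snd_conv
    by (intro sum.cong refl arg_cong2[of _ _ _ _ "(*)"] prod.cong "1.IH" "1.prems"(1,2))
      (auto simp: PiE_iff)
  finally show ?case .
qed

end

section \<open>Pulling the component sums of grafted branches out of the tree\<close>

lemma sum_PiE_insert:
  assumes "j \<notin> I"
  shows "(\<Sum>c\<in>Pi\<^sub>E (insert j I) T. g c) = (\<Sum>d\<in>T j. \<Sum>c\<in>Pi\<^sub>E I T. g (c(j := d)))"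
  unfolding PiE_insert_eq sum.cartesian_product
  by (subst sum.reindex[OF inj_combinator[OF assms]]) (simp add: split_def)

lemma image_mset_mset_set_upd:
  "j \<notin> K \<Longrightarrow> image_mset (\<lambda>x. f x (if x = j then d else c x)) (mset_set K) = image_mset (\<lambda>x. f x (c x)) (mset_set K)"
  by (rule image_mset_mset_set_cong) auto

lemma directional_empty [simp]: "directional dm k {} a h f = total_derivs dm k f"
  by (simp add: directional_def)

lemma directional_insert:
  assumes "finite K" "j \<notin> K"
  shows "directional dm k (insert j K) a h f
    = (\<Sum>d<dm (fst (a j)). h j d * directional dm k K a h (partial (a j, d) f))"
proof -
  have prod: "(\<Prod>x\<in>K. h x (if x = j then d else c x)) = (\<Prod>x\<in>K. h x (c x))" for c d
    using assms by (intro prod.cong) auto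
  have partial: "partials (add_mset v M) f = partials M (partial v f)" for v M
    using partials_union[of M "{#v#}" f] by simp
  show ?thesis
    unfolding directional_def sum_PiE_insert[OF assms(2)] sum_distrib_left
    using assms by (intro sum.cong refl)
      (simp add: prod image_mset_mset_set_upd[where f = "\<lambda>x y. (a x, y)"] partial mult_ac del: partials_add_mset)
qed

text \<open>Each \<open>j\<close> sits at exactly one node \<open>v j\<close>, so inserting it
  changes the operator there only, and \<open>node_prod_sum\<close> moves its component sum and its
  factor to the outside.\<close>

lemma node_prod_directional:
  assumes "finite I" "\<And>j. j \<in> I \<Longrightarrow> v j \<in> nodes \<tau>"
  shows "node_prod dm G (\<lambda>u f. directional dm (\<nu> u) {j \<in> I. v j = u} a h (partials (\<delta> u) f)) \<tau> i c
    = (\<Sum>e\<in>(\<Pi>\<^sub>E j\<in>I. {..<dm (fst (a j))}). (\<Prod>j\<in>I. h j (e j))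
      * decorated_prod dm G \<nu> (\<lambda>u. {#(a j, e j). j \<in># mset_set {j \<in> I. v j = u}#} + \<delta> u) \<tau> i c)"
  using assms
proof (induction I arbitrary: \<delta> rule: finite_induct)
  case (insert j I)
  let ?P = "\<lambda>\<delta> u f. directional dm (\<nu> u) {j \<in> I. v j = u} a h (partials (\<delta> u) f)"
  let ?Q = "\<lambda>u f. directional dm (\<nu> u) {j' \<in> insert j I. v j' = u} a h (partials (\<delta> u) f)"
  let ?\<delta> = "\<lambda>d. \<delta>(v j := add_mset (a j, d) (\<delta> (v j)))"
  have set_eq: "{j' \<in> insert j I. v j' = u} = (if u = v j then insert j {j \<in> I. v j = u} else {j \<in> I. v j = u})"
    for u by auto
  have "?Q (v j) = (\<lambda>f. \<Sum>d<dm (fst (a j)). h j d * ?P (?\<delta> d) (v j) f)"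
    unfolding set_eq using insert.hyps by (simp add: directional_insert fun_eq_iff)
  moreover have "?Q(v j := ?P (?\<delta> d) (v j)) = ?P (?\<delta> d)" for d
    unfolding set_eq by (auto simp: fun_eq_iff)
  ultimately have "node_prod dm G ?Q \<tau> i c
      = (\<Sum>d<dm (fst (a j)). h j d * node_prod dm G (?P (?\<delta> d)) \<tau> i c)"
    using node_prod_sum[of "v j" \<tau> ?Q "\<lambda>d. h j d" "\<lambda>d. ?P (?\<delta> d) (v j)" "{..<dm (fst (a j))}" dm G i c]
      insert.prems by simp
  also have "\<dots> = (\<Sum>d<dm (fst (a j)). h j d * (\<Sum>e\<in>(\<Pi>\<^sub>E j\<in>I. {..<dm (fst (a j))}). (\<Prod>j\<in>I. h j (e j))
      * decorated_prod dm G \<nu> (\<lambda>u. {#(a j, e j). j \<in># mset_set {j \<in> I. v j = u}#} + ?\<delta> d u) \<tau> i c))"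
    using insert.prems by (subst insert.IH) auto
  also have "\<dots> = (\<Sum>e\<in>(\<Pi>\<^sub>E j\<in>insert j I. {..<dm (fst (a j))}). (\<Prod>j\<in>insert j I. h j (e j))
      * decorated_prod dm G \<nu> (\<lambda>u. {#(a j, e j). j \<in># mset_set {j' \<in> insert j I. v j' = u}#} + \<delta> u) \<tau> i c)"
    unfolding sum_PiE_insert[OF insert.hyps(2)] sum_distrib_left mult.assoc[symmetric]
  proof (intro sum.cong refl arg_cong2[of _ _ _ _ "(*)"])
    fix d e
    have "(\<Prod>x\<in>I. h x ((e(j := d)) x)) = (\<Prod>x\<in>I. h x (e x))"
      using insert.hyps by (intro prod.cong) auto
    then show "h j d * (\<Prod>x\<in>I. h x (e x)) = (\<Prod>x\<in>insert j I. h x ((e(j := d)) x))"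
      using insert.hyps by simp
    have "{#(a x, e x). x \<in># mset_set {j \<in> I. v j = u}#} + ?\<delta> d u
        = {#(a x, (e(j := d)) x). x \<in># mset_set {j' \<in> insert j I. v j' = u}#} + \<delta> u" for u
      unfolding set_eq using insert.hyps
      by (auto simp: image_mset_mset_set_upd[where f = "\<lambda>x y. (a x, y)"])
    then show "decorated_prod dm G \<nu> (\<lambda>u. {#(a x, e x). x \<in># mset_set {j \<in> I. v j = u}#} + ?\<delta> d u) \<tau> i c
      = decorated_prod dm G \<nu> (\<lambda>u. {#(a x, (e(j := d)) x). x \<in># mset_set {j' \<in> insert j I. v j' = u}#} + \<delta> u) \<tau> i c"
      by simp
  qed
  finally show ?case .
qed simp


text \<open>The Leibniz rule selects a node \<open>u\<close>; there
  \<open>partial_total_derivs\<close> restores the normal form at the price of a shift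
  \<open>m\<close>, taken both from the decoration of \<open>u\<close> and from the edge.\<close>

lemma partial_decorated_prod:
  assumes "c' < dm t"
  shows "partial ((t, p), c') (decorated_prod dm G \<nu> \<delta> \<tau> i c)
    = (\<Sum>u\<in>nodes \<tau>. \<Sum>m\<in>{..p}. mbinom (\<nu> u) m *\<^sub>R decorated_prod dm G
        (\<nu>(u := \<nu> u - m)) (\<delta>(u := add_mset ((t, p - m), c') (\<delta> u))) \<tau> i c)"
  unfolding derivation_node_prod[OF derivation_partial]
proof (intro sum.cong refl)
  fix u assume u: "u \<in> nodes \<tau>"
  let ?P = "\<lambda>\<nu> \<delta> u f. total_derivs dm (\<nu> u) (partials (\<delta> u) f)"
  let ?\<nu> = "\<lambda>m. \<nu>(u := \<nu> u - m)" and ?\<delta> = "\<lambda>m. \<delta>(u := add_mset ((t, p - m), c') (\<delta> u))"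
  let ?Q = "(?P \<nu> \<delta>)(u := \<lambda>f. partial ((t, p), c') (?P \<nu> \<delta> u f))"
  have "?Q u = (\<lambda>f. \<Sum>m\<in>{..p}. of_real (mbinom (\<nu> u) m) * ?P (?\<nu> m) (?\<delta> m) u f)"
    by (simp add: partial_total_derivs[where dm = dm and t = t and c = c', OF assms] fun_eq_iff scaleR_conv_of_real)
  moreover have "?Q(u := ?P (?\<nu> m) (?\<delta> m) u) = ?P (?\<nu> m) (?\<delta> m)" for m
    by (auto simp: fun_eq_iff)
  ultimately show "node_prod dm G ?Q \<tau> i c
      = (\<Sum>m\<in>{..p}. mbinom (\<nu> u) m *\<^sub>R node_prod dm G (?P (?\<nu> m) (?\<delta> m)) \<tau> i c)"
    using node_prod_sum[OF u, of ?Q "\<lambda>m. of_real (mbinom (\<nu> u) m)" "\<lambda>m. ?P (?\<nu> m) (?\<delta> m) u" "{..p}" dm G i c]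
    by (simp add: scaleR_conv_of_real)
qed

section \<open>Multinomial weights for grafting one branch at a time\<close>

definition loads :: "'x set \<Rightarrow> ('x \<Rightarrow> 'u) \<Rightarrow> ('x \<Rightarrow> (nat, 'i::finite) vec) \<Rightarrow> 'u \<Rightarrow> (nat, 'i) vec"
  where "loads I v m u = (\<Sum>j\<in>{j \<in> I. v j = u}. m j)"

lemma fibre_insert:
  "j \<notin> I \<Longrightarrow> {x \<in> insert j I. (v(j := u)) x = w} = (if w = u then insert j {x \<in> I. v x = w} else {x \<in> I. v x = w})"
  by auto

lemma loads_insert:
  assumes "finite I" "j \<notin> I"
  shows "loads (insert j I) (v(j := u)) (m(j := q)) w = loads I v m w + (if w = u then q else 0)"
proof -
  have "(\<Sum>x\<in>{x \<in> I. v x = w}. (m(j := q)) x) = (\<Sum>x\<in>{x \<in> I. v x = w}. m x)" for w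
    using assms by (intro sum.cong) auto
  then show ?thesis
    unfolding loads_def fibre_insert[OF assms(2)] using assms by (simp add: add.commute)
qed

text \<open>Extends \<open>graft_coeff\<close> to arbitrary index sets, for an induction over
  indices, and by 0 to inadmissible shifts, so that these range over a full product set.\<close>

definition graft_weight ::
  "('u \<Rightarrow> (nat, 'i::finite) vec) \<Rightarrow> 'u set \<Rightarrow> 'x set \<Rightarrow> ('x \<Rightarrow> 'u) \<Rightarrow> ('x \<Rightarrow> (nat, 'i) vec) \<Rightarrow> real"
  where "graft_weight \<nu> N I v m = (if \<forall>u\<in>N. loads I v m u \<le> \<nu> u
    then \<Prod>u\<in>N. mfact (\<nu> u) / (mfact (\<nu> u - loads I v m u) * (\<Prod>j\<in>{j \<in> I. v j = u}. mfact (m j)))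
    else 0)"

lemma mfact_nonzero: "mfact k \<noteq> 0"
  by (simp add: mfact_def)

text \<open>The telescoping step: the new shift \<open>q\<close> is drawn from what the earlier
  branches left at \<open>u\<close>, and binomial times multinomial is the larger multinomial. If
  \<open>q\<close> exceeds the remainder, or the earlier load was already too large, both sides
  vanish.\<close>

lemma graft_weight_insert:
  assumes N: "finite N" "u \<in> N" and I: "finite I" "j \<notin> I"
  shows "graft_weight \<nu> N (insert j I) (v(j := u)) (m(j := q))
    = graft_weight \<nu> N I v m * mbinom (\<nu> u - loads I v m u) q"
proof -
  let ?L = "loads I v m" and ?L' = "loads (insert j I) (v(j := u)) (m(j := q))"
  let ?F = "\<lambda>w. \<Prod>x\<in>{x \<in> I. v x = w}. mfact (m x)"
  have L': "?L' w = ?L w + (if w = u then q else 0)" for w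
    by (rule loads_insert[OF I])
  have "(\<Prod>x\<in>{x \<in> I. v x = w}. mfact ((m(j := q)) x)) = ?F w" for w
    using I by (intro prod.cong) auto
  then have F': "(\<Prod>x\<in>{x \<in> insert j I. (v(j := u)) x = w}. mfact ((m(j := q)) x))
      = (if w = u then mfact q else 1) * ?F w" for w
    unfolding fibre_insert[OF I(2)] using I by simp
  show ?thesis
  proof (cases "\<forall>w\<in>N. ?L w \<le> \<nu> w")
    case L: True
    show ?thesis
    proof (cases "q \<le> \<nu> u - ?L u")
      case q: True
      have "?L u + q \<le> \<nu> u"
        using q L N(2) unfolding less_eq_vec_def by (force simp: le_diff_conv2 add.commute)
      then have "\<forall>w\<in>N. ?L' w \<le> \<nu> w" using L by (auto simp: L')
      moreover have "\<nu> u - (?L u + q) = \<nu> u - ?L u - q" by (simp add: vec_eq_iff)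
      ultimately show ?thesis
        using L unfolding graft_weight_def F' prod.remove[OF N]
        by (simp add: L' mbinom_eq_mfact[OF q] mfact_nonzero field_simps cong: prod.cong_simp)
    next
      case q: False
      then have "\<not> ?L' u \<le> \<nu> u"
        by (auto simp: L' less_eq_vec_def) (metis add_diff_cancel_left' diff_le_mono)
      with N(2) q show ?thesis by (auto simp: graft_weight_def mbinom_eq_0)
    qed
  next
    case False
    then obtain w where "w \<in> N" "\<not> ?L w \<le> \<nu> w" by blast
    then have "\<not> ?L' w \<le> \<nu> w"
      unfolding L' less_eq_vec_def by (metis add_leD1 vector_add_component)
    with \<open>w \<in> N\<close> False show ?thesis unfolding graft_weight_def by auto
  qed
qed

lemma sum_swap_inner:
  "(\<Sum>a\<in>A. \<Sum>b\<in>B. \<Sum>c\<in>C. \<Sum>d\<in>D c. g a b c d) = (\<Sum>c\<in>C. \<Sum>a\<in>A. \<Sum>d\<in>D c. \<Sum>b\<in>B. g a b c d)"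
proof -
  have "(\<Sum>a\<in>A. \<Sum>b\<in>B. \<Sum>c\<in>C. \<Sum>d\<in>D c. g a b c d) = (\<Sum>a\<in>A. \<Sum>c\<in>C. \<Sum>b\<in>B. \<Sum>d\<in>D c. g a b c d)"
    by (intro sum.cong refl sum.swap)
  also have "\<dots> = (\<Sum>c\<in>C. \<Sum>a\<in>A. \<Sum>b\<in>B. \<Sum>d\<in>D c. g a b c d)"
    by (rule sum.swap)
  also have "\<dots> = (\<Sum>c\<in>C. \<Sum>a\<in>A. \<Sum>d\<in>D c. \<Sum>b\<in>B. g a b c d)"
    by (intro sum.cong refl sum.swap)
  finally show ?thesis .
qed

text \<open>Each further D_a extends \<open>v\<close> by a node and \<open>m\<close> by a shift, and
  its binomial coefficient is absorbed by \<open>graft_weight_insert\<close>. No derivative falls on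
  branches grafted earlier, since \<open>\<delta>\<close> records variables and not the
  differentials of those branches; hence all targets are nodes of \<open>\<tau>\<close>.\<close>

lemma partials_decorated_prod:
  fixes a :: "'x \<Rightarrow> ('i::{finite,linorder}, 'o) edge"
  assumes "finite I" "\<And>j. j \<in> I \<Longrightarrow> e j < dm (fst (a j))"
  shows "partials {#(a j, e j). j \<in># mset_set I#} (decorated_prod dm G \<nu> \<delta> \<tau> i c)
    = (\<Sum>v\<in>I \<rightarrow>\<^sub>E nodes \<tau>. \<Sum>m\<in>(\<Pi>\<^sub>E j\<in>I. {..snd (a j)}). graft_weight \<nu> (nodes \<tau>) I v m *\<^sub>R
        decorated_prod dm G (\<lambda>u. \<nu> u - loads I v m u)
          (\<lambda>u. {#((fst (a j), snd (a j) - m j), e j). j \<in># mset_set {j \<in> I. v j = u}#} + \<delta> u) \<tau> i c)"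
  using assms
proof (induction I rule: finite_induct)
  case empty
  show ?case by (simp add: graft_weight_def loads_def mfact_nonzero less_eq_vec_def)
next
  case (insert j I)
  let ?b = "\<lambda>m x. ((fst (a x), snd (a x) - m x), e x)"
  let ?\<nu> = "\<lambda>I v m u. \<nu> u - loads I v m u"
  let ?\<delta> = "\<lambda>I v m u. image_mset (?b m) (mset_set {j \<in> I. v j = u}) + \<delta> u"
  let ?D = "\<lambda>\<nu> \<delta>. decorated_prod dm G \<nu> \<delta> \<tau> i c"
  let ?w = "\<lambda>I v m. graft_weight \<nu> (nodes \<tau>) I v m"
  obtain t p where tp: "a j = (t, p)" by (cases "a j")
  have ej: "e j < dm t" using insert.prems[of j] tp by simp
  have upd: "?w I v m *\<^sub>R mbinom (?\<nu> I v m u) q *\<^sub>R ?D ((?\<nu> I v m)(u := ?\<nu> I v m u - q))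
        ((?\<delta> I v m)(u := add_mset ((t, p - q), e j) (?\<delta> I v m u)))
      = ?w (insert j I) (v(j := u)) (m(j := q)) *\<^sub>R ?D (?\<nu> (insert j I) (v(j := u)) (m(j := q)))
        (?\<delta> (insert j I) (v(j := u)) (m(j := q)))" if u: "u \<in> nodes \<tau>" for v m u q
  proof -
    have "(?\<nu> I v m)(u := ?\<nu> I v m u - q) = ?\<nu> (insert j I) (v(j := u)) (m(j := q))"
      unfolding loads_insert[OF insert.hyps] by (auto simp: fun_eq_iff vec_eq_iff)
    moreover have "(?\<delta> I v m)(u := add_mset ((t, p - q), e j) (?\<delta> I v m u))
        = ?\<delta> (insert j I) (v(j := u)) (m(j := q))"
    proof
      fix w
      have "image_mset (?b (m(j := q))) (mset_set {x \<in> I. v x = w}) = image_mset (?b m) (mset_set {x \<in> I. v x = w})" for w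
        using insert.hyps by (intro image_mset_mset_set_cong) auto
      then show "((?\<delta> I v m)(u := add_mset ((t, p - q), e j) (?\<delta> I v m u))) w
        = ?\<delta> (insert j I) (v(j := u)) (m(j := q)) w"
        unfolding fibre_insert[OF insert.hyps(2)] using insert.hyps by (simp add: tp)
    qed
    ultimately show ?thesis
      using graft_weight_insert[OF finite_nodes u insert.hyps, of \<nu> v m q] by simp
  qed
  have "partials (image_mset (\<lambda>x. (a x, e x)) (mset_set (insert j I))) (?D \<nu> \<delta>)
      = partial ((t, p), e j) (\<Sum>v\<in>I \<rightarrow>\<^sub>E nodes \<tau>. \<Sum>m\<in>(\<Pi>\<^sub>E j\<in>I. {..snd (a j)}).
          ?w I v m *\<^sub>R ?D (?\<nu> I v m) (?\<delta> I v m))"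
    using insert by (simp add: tp)
  also have "\<dots> = (\<Sum>v\<in>I \<rightarrow>\<^sub>E nodes \<tau>. \<Sum>m\<in>(\<Pi>\<^sub>E j\<in>I. {..snd (a j)}).
      \<Sum>u\<in>nodes \<tau>. \<Sum>q\<in>{..p}. ?w I v m *\<^sub>R mbinom (?\<nu> I v m u) q *\<^sub>R
        ?D ((?\<nu> I v m)(u := ?\<nu> I v m u - q)) ((?\<delta> I v m)(u := add_mset ((t, p - q), e j) (?\<delta> I v m u))))"
    unfolding linear_sum[OF linear_partial] o_def linear_scale[OF linear_partial]
      partial_decorated_prod[where dm = dm, OF ej] scaleR_sum_right ..
  \<comment> \<open>Puts the new node before the old ones and the new shift before the old ones, the
    order in which \<open>sum_PiE_insert\<close> splits off a value.\<close>
  also have "\<dots> = (\<Sum>u\<in>nodes \<tau>. \<Sum>v\<in>I \<rightarrow>\<^sub>E nodes \<tau>. \<Sum>q\<in>{..p}. \<Sum>m\<in>(\<Pi>\<^sub>E j\<in>I. {..snd (a j)}).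
      ?w I v m *\<^sub>R mbinom (?\<nu> I v m u) q *\<^sub>R
        ?D ((?\<nu> I v m)(u := ?\<nu> I v m u - q)) ((?\<delta> I v m)(u := add_mset ((t, p - q), e j) (?\<delta> I v m u))))"
    by (rule sum_swap_inner)
  also have "\<dots> = (\<Sum>u\<in>nodes \<tau>. \<Sum>v\<in>I \<rightarrow>\<^sub>E nodes \<tau>. \<Sum>q\<in>{..snd (a j)}. \<Sum>m\<in>(\<Pi>\<^sub>E j\<in>I. {..snd (a j)}).
      ?w (insert j I) (v(j := u)) (m(j := q)) *\<^sub>R ?D (?\<nu> (insert j I) (v(j := u)) (m(j := q)))
        (?\<delta> (insert j I) (v(j := u)) (m(j := q))))"
    by (intro sum.cong refl upd) (simp_all add: tp)
  also have "\<dots> = (\<Sum>v\<in>insert j I \<rightarrow>\<^sub>E nodes \<tau>. \<Sum>m\<in>(\<Pi>\<^sub>E j\<in>insert j I. {..snd (a j)}).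
      ?w (insert j I) v m *\<^sub>R ?D (?\<nu> (insert j I) v m) (?\<delta> (insert j I) v m))"
    unfolding sum_PiE_insert[OF insert.hyps(2)] ..
  finally show ?case .
qed

text \<open>In the normal form \<partial>_r meets the outermost operators, so raising a decoration
  costs no commutator.\<close>

lemma total_deriv_decorated_prod:
  "total_deriv dm r (decorated_prod dm G \<nu> \<delta> \<tau> i c)
    = (\<Sum>u\<in>nodes \<tau>. decorated_prod dm G (\<nu>(u := \<nu> u + axis r 1)) \<delta> \<tau> i c)"
  unfolding derivation_node_prod[OF derivation_total_deriv]
  by (intro sum.cong refl arg_cong[of _ _ "\<lambda>P. node_prod dm G P \<tau> i c"])
    (auto simp: fun_eq_iff total_derivs_add_axis)

lemma finite_slots [simp]: "finite (slots k)"
  by (simp add: slots_def)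

lemma slots_add_axis: "slots (k + axis r 1) = insert (r, k $ r) (slots k)"
  by (auto simp: slots_def axis_nth_nat split: if_splits)

text \<open>Every single \<partial>_r in \<partial>^k chooses its node independently; the choices
  are the maps \<open>w\<close> in the expanded operator \<up>^k.\<close>

lemma total_derivs_decorated_prod:
  fixes \<tau> :: "('i::{finite,linorder}, 'n, 'o) dtree"
  shows "total_derivs dm k (decorated_prod dm G \<nu> \<delta> \<tau> i c)
    = (\<Sum>w\<in>slots k \<rightarrow>\<^sub>E nodes \<tau>. decorated_prod dm G (\<lambda>u. \<nu> u + raised k w u) \<delta> \<tau> i c)"
proof (induction k rule: vec_nat_induct)
  case zero
  have "slots (0 :: (nat, 'i) vec) = {}" by (simp add: slots_def)
  then show ?case by (simp add: raised_def)
next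
  case (add_axis k r)
  let ?q = "(r, k $ r)"
  have q: "?q \<notin> slots k" by (simp add: slots_def)
  have raised: "raised (k + axis r 1) (w(?q := u)) u' = raised k w u' + (if u' = u then axis r 1 else 0)"
    for w :: "'i \<times> nat \<Rightarrow> ('i, 'n, 'o) occ list" and u u'
  proof -
    have "(\<Sum>x\<in>{x \<in> slots k. w x = u'}. axis (fst x) 1) = raised k w u'"
      by (simp add: raised_def)
    then show ?thesis
      unfolding raised_def slots_add_axis fibre_insert[OF q] using q by (simp add: add.commute)
  qed
  have "total_derivs dm (k + axis r 1) (decorated_prod dm G \<nu> \<delta> \<tau> i c)
      = (\<Sum>w\<in>slots k \<rightarrow>\<^sub>E nodes \<tau>. \<Sum>u\<in>nodes \<tau>.
          decorated_prod dm G ((\<lambda>u. \<nu> u + raised k w u)(u := \<nu> u + raised k w u + axis r 1)) \<delta> \<tau> i c)"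
    unfolding total_derivs_add_axis add_axis linear_sum[OF linear_total_deriv] o_def
      total_deriv_decorated_prod ..
  also have "\<dots> = (\<Sum>u\<in>nodes \<tau>. \<Sum>w\<in>slots k \<rightarrow>\<^sub>E nodes \<tau>.
      decorated_prod dm G (\<lambda>u'. \<nu> u' + raised (k + axis r 1) (w(?q := u)) u') \<delta> \<tau> i c)"
    unfolding raised
    by (subst sum.swap) (intro sum.cong refl arg_cong[of _ _ "\<lambda>\<nu>. decorated_prod dm G \<nu> \<delta> \<tau> i c"],
      auto simp: fun_eq_iff add.assoc)
  also have "\<dots> = (\<Sum>w\<in>slots (k + axis r 1) \<rightarrow>\<^sub>E nodes \<tau>.
      decorated_prod dm G (\<lambda>u. \<nu> u + raised (k + axis r 1) w u) \<delta> \<tau> i c)"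
    unfolding slots_add_axis sum_PiE_insert[OF q] ..
  finally show ?case .
qed


section \<open>The morphism property of elementary differentials\<close>

lemma sum_rotate:
  "(\<Sum>e\<in>E. \<Sum>v\<in>V. \<Sum>m\<in>M v. \<Sum>w\<in>W. g e v m w) = (\<Sum>v\<in>V. \<Sum>m\<in>M v. \<Sum>w\<in>W. \<Sum>e\<in>E. g e v m w)"
  by (subst sum.swap, intro sum.cong refl, subst sum.swap, intro sum.cong refl, rule sum.swap)

lemma graft_weight_occs:
  "graft_weight (dec_at \<tau>) (nodes \<tau>) (occs B) v m
    = (if \<forall>u\<in>nodes \<tau>. load B v m u \<le> dec_at \<tau> u then graft_coeff B \<tau> v m else 0)"
  by (simp add: graft_weight_def graft_coeff_def loads_def load_def)

text \<open>Of the two bounds in \<open>shifts\<close>, the one by edge decorations is the product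
  set on the right, and the one by node decorations is encoded in the vanishing of
  \<open>graft_weight\<close>.\<close>

lemma sum_shifts:
  fixes g :: "_ \<Rightarrow> 'z::real_vector"
  shows "(\<Sum>m\<in>shifts B \<tau> v. graft_coeff B \<tau> v m *\<^sub>R g m)
    = (\<Sum>m\<in>(\<Pi>\<^sub>E j\<in>occs B. {..snd (fst (fst j))}). graft_weight (dec_at \<tau>) (nodes \<tau>) (occs B) v m *\<^sub>R g m)"
proof -
  let ?M = "\<Pi>\<^sub>E j\<in>occs B. {..snd (fst (fst j))}"
  have "shifts B \<tau> v = {m \<in> ?M. \<forall>u\<in>nodes \<tau>. load B v m u \<le> dec_at \<tau> u}"
    by (auto simp: shifts_def PiE_iff)
  moreover have "finite ?M" by (intro finite_PiE) auto
  ultimately show ?thesis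
    by (auto simp: graft_weight_occs sum.inter_filter intro!: sum.cong)
qed

text \<open>Both sides expand to one sum over components \<open>e\<close>, target nodes
  \<open>v\<close>, shifts \<open>m\<close> and raised nodes \<open>w\<close>. On the left the
  derivatives are pushed to the nodes of \<open>\<tau>\<close>; on the right each grafted tree is
  unfolded and the differentials of its new branches are pulled out.\<close>

lemma directional_elem_field:
  fixes \<tau> :: "('i::{finite,linorder}, 'n, 'o) dtree"
  assumes "smooth_nonlinearity dm F G" "c < dm i"
  shows "directional dm k (occs B) (\<lambda>j. fst (fst j))
      (\<lambda>j. elem_field dm F (snd (fst j)) (fst (fst (fst j)))) (elem_field dm F \<tau> i c)
    = (\<Sum>v\<in>occs B \<rightarrow>\<^sub>E nodes \<tau>. \<Sum>m\<in>shifts B \<tau> v. \<Sum>w\<in>slots k \<rightarrow>\<^sub>E nodes \<tau>.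
        graft_coeff B \<tau> v m *\<^sub>R elem_field dm F
          (modify (\<lambda>u. dec_at \<tau> u - load B v m u + raised k w u) (grafts B v m) \<tau>) i c)"
proof -
  interpret smooth_nonlinearity dm F G by fact
  let ?a = "\<lambda>j. fst (fst j)" and ?h = "\<lambda>j. elem_field dm F (snd (fst j)) (fst (fst (fst j)))"
  let ?E = "\<Pi>\<^sub>E j\<in>occs B. {..<dm (fst (?a j))}"
  let ?M = "\<Pi>\<^sub>E j\<in>occs B. {..snd (?a j)}"
  let ?\<nu> = "\<lambda>v m w u. dec_at \<tau> u - load B v m u + raised k w u"
  let ?\<delta> = "\<lambda>e v m u. {#((fst (?a j), snd (?a j) - m j), e j). j \<in># mset_set {j \<in> occs B. v j = u}#}"
  let ?D = "\<lambda>\<nu> \<delta>. decorated_prod dm G \<nu> \<delta> \<tau> i c"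
  let ?g = "graft_weight (dec_at \<tau>) (nodes \<tau>) (occs B)"
  have load: "loads (occs B) v m u = load B v m u" for v m and u :: "('i, 'n, 'o) occ list"
    by (simp add: loads_def load_def)
  \<comment> \<open>The shift changes the edge of a grafted branch but not its operator type, so the
    factor \<open>?h j\<close> and the range of its component do not depend on
    \<open>m\<close>.\<close>
  have graft: "elem_field dm F (modify (?\<nu> v m w) (grafts B v m) \<tau>) i c
      = (\<Sum>e\<in>?E. (\<Prod>j\<in>occs B. ?h j (e j)) * ?D (?\<nu> v m w) (?\<delta> e v m))"
    if v: "v \<in> occs B \<rightarrow>\<^sub>E nodes \<tau>" for v m w
  proof -
    let ?\<phi> = "\<lambda>j. case j of (((t, p), \<sigma>), n) \<Rightarrow> ((t, p - m j), \<sigma>)"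
    have \<phi>: "fst (?\<phi> j) = (fst (?a j), snd (?a j) - m j)" "snd (?\<phi> j) = snd (fst j)" for j
      by (auto split: prod.split)
    have "elem_field dm F (modify (?\<nu> v m w) (grafts B v m) \<tau>) i c
        = node_prod dm G (\<lambda>u. directional dm (?\<nu> v m w u) {j \<in> occs B. v j = u}
            (\<lambda>j. fst (?\<phi> j)) (\<lambda>j. elem_field dm F (snd (?\<phi> j)) (fst (fst (?\<phi> j))))) \<tau> i c"
      by (rule elem_field_modify) (auto simp: grafts_def assms(2))
    also have "\<dots> = node_prod dm G (\<lambda>u f. directional dm (?\<nu> v m w u) {j \<in> occs B. v j = u}
        (\<lambda>j. (fst (?a j), snd (?a j) - m j)) ?h (partials {#} f)) \<tau> i c"
      by (simp add: \<phi>)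
    also have "\<dots> = (\<Sum>e\<in>?E. (\<Prod>j\<in>occs B. ?h j (e j)) * ?D (?\<nu> v m w) (?\<delta> e v m))"
      using v by (subst node_prod_directional) (auto simp: PiE_iff)
    finally show ?thesis .
  qed
  have "directional dm k (occs B) ?a ?h (elem_field dm F \<tau> i c)
      = (\<Sum>e\<in>?E. (\<Prod>j\<in>occs B. ?h j (e j)) * (\<Sum>v\<in>occs B \<rightarrow>\<^sub>E nodes \<tau>. \<Sum>m\<in>?M.
          ?g v m *\<^sub>R (\<Sum>w\<in>slots k \<rightarrow>\<^sub>E nodes \<tau>. ?D (?\<nu> v m w) (?\<delta> e v m))))"
    unfolding directional_def elem_field_eq_decorated_prod[OF assms(2)]
  proof (intro sum.cong refl arg_cong2[of _ _ _ _ "(*)"])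
    fix e assume "e \<in> ?E"
    then show "total_derivs dm k (partials {#(?a j, e j). j \<in># mset_set (occs B)#} (?D (dec_at \<tau>) (\<lambda>u. {#})))
        = (\<Sum>v\<in>occs B \<rightarrow>\<^sub>E nodes \<tau>. \<Sum>m\<in>?M.
          ?g v m *\<^sub>R (\<Sum>w\<in>slots k \<rightarrow>\<^sub>E nodes \<tau>. ?D (?\<nu> v m w) (?\<delta> e v m)))"
      by (subst partials_decorated_prod)
        (auto simp: PiE_iff linear_sum[OF linear_total_derivs] linear_scale[OF linear_total_derivs]
          total_derivs_decorated_prod load)
  qed
  also have "\<dots> = (\<Sum>e\<in>?E. \<Sum>v\<in>occs B \<rightarrow>\<^sub>E nodes \<tau>. \<Sum>m\<in>?M. \<Sum>w\<in>slots k \<rightarrow>\<^sub>E nodes \<tau>.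
      ?g v m *\<^sub>R ((\<Prod>j\<in>occs B. ?h j (e j)) * ?D (?\<nu> v m w) (?\<delta> e v m)))"
    by (simp add: sum_distrib_left scaleR_sum_right)
  also have "\<dots> = (\<Sum>v\<in>occs B \<rightarrow>\<^sub>E nodes \<tau>. \<Sum>m\<in>?M. \<Sum>w\<in>slots k \<rightarrow>\<^sub>E nodes \<tau>. \<Sum>e\<in>?E.
      ?g v m *\<^sub>R ((\<Prod>j\<in>occs B. ?h j (e j)) * ?D (?\<nu> v m w) (?\<delta> e v m)))"
    by (rule sum_rotate)
  also have "\<dots> = (\<Sum>v\<in>occs B \<rightarrow>\<^sub>E nodes \<tau>. \<Sum>m\<in>?M. ?g v m *\<^sub>R
      (\<Sum>w\<in>slots k \<rightarrow>\<^sub>E nodes \<tau>. elem_field dm F (modify (?\<nu> v m w) (grafts B v m) \<tau>) i c))"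
    by (simp add: graft scaleR_sum_right)
  finally show ?thesis
    by (simp only: scaleR_sum_right[symmetric] sum_shifts)
qed

section \<open>Linear extension, and trees as products with a single noise\<close>

lemma lin_ext_superset:
  assumes "finite S" "Poly_Mapping.keys x \<subseteq> S"
  shows "lin_ext f x = (\<Sum>a\<in>S. Poly_Mapping.lookup x a *\<^sub>R f a)"
  unfolding lin_ext_def using assms by (intro sum.mono_neutral_left) (auto simp: in_keys_iff)

lemma linear_lin_ext: "linear (lin_ext f)"
proof (rule linearI)
  fix x y :: "'a \<Rightarrow>\<^sub>0 real"
  let ?S = "Poly_Mapping.keys x \<union> Poly_Mapping.keys y"
  show "lin_ext f (x + y) = lin_ext f x + lin_ext f y"
    using Poly_Mapping.keys_add[of x y]
    by (simp add: lin_ext_superset[of ?S] lookup_add scaleR_left_distrib sum.distrib)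
next
  fix r and x :: "'a \<Rightarrow>\<^sub>0 real"
  have "Poly_Mapping.lookup (r *\<^sub>R x) a = r * Poly_Mapping.lookup x a" for a
    by (simp add: scaleR_poly_mapping.rep_eq)
  then show "lin_ext f (r *\<^sub>R x) = r *\<^sub>R lin_ext f x"
    by (subst lin_ext_superset[of "Poly_Mapping.keys x"])
      (auto simp: lin_ext_def scaleR_sum_right in_keys_iff)
qed

lemma lin_ext_basis [simp]: "lin_ext f (basis a) = f a"
  by (simp add: lin_ext_def)

text \<open>Passes from trees to linear combinations, since the adjoint of a noise need not be a
  single tree; \<open>directional\<close> is linear in its last argument.\<close>

lemma lin_ext_elem_field_star:
  assumes "smooth_nonlinearity dm F G" "c < dm i"
  shows "lin_ext (\<lambda>\<tau>. elem_field dm F \<tau> i c) (basis (Node k None B) \<star> y)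
    = directional dm k (occs B) (\<lambda>j. fst (fst j))
      (\<lambda>j. elem_field dm F (snd (fst j)) (fst (fst (fst j)))) (lin_ext (\<lambda>\<tau>. elem_field dm F \<tau> i c) y)"
proof -
  have "lin_ext (\<lambda>\<tau>. elem_field dm F \<tau> i c) (star_tree (Node k None B) \<tau>)
      = directional dm k (occs B) (\<lambda>j. fst (fst j))
        (\<lambda>j. elem_field dm F (snd (fst j)) (fst (fst (fst j)))) (elem_field dm F \<tau> i c)" for \<tau>
    unfolding directional_elem_field[OF assms]
    by (simp add: star_tree_def Let_def linear_sum[OF linear_lin_ext] linear_scale[OF linear_lin_ext])
  then show ?thesis
    by (simp add: star_def lin_ext_def[of _ y] linear_sum[OF linear_lin_ext] linear_scale[OF linear_lin_ext]
      linear_sum[OF linear_directional] linear_scale[OF linear_directional])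
qed

lemma occs_empty [simp]: "occs {#} = {}"
  by (simp add: occs_def)

text \<open>The second factor has a single node, with decoration 0. All branches and all units of
  \<open>k\<close> go to that node and no shift is possible, which leaves one term, with coefficient
  1.\<close>

lemma star_noise:
  fixes C :: "(('i::finite, 'o) edge \<times> ('i, 'n, 'o) dtree) multiset"
  shows "basis (Node k None C) \<star> basis (Node 0 l {#}) = basis (Node k l C)"
proof -
  let ?\<zeta> = "Node 0 l {#} :: ('i, 'n, 'o) dtree"
  let ?v = "\<lambda>j\<in>occs C. [] :: ('i, 'n, 'o) occ list" and ?m = "\<lambda>j\<in>occs C. 0 :: (nat, 'i) vec"
  let ?w = "\<lambda>q\<in>slots k. [] :: ('i, 'n, 'o) occ list"
  have fibre: "{j \<in> occs C. ?v j = []} = occs C" by auto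
  have load: "load C ?v m [] = (\<Sum>j\<in>occs C. m j)" for m :: "_ \<Rightarrow> (nat, 'i) vec"
    unfolding load_def fibre ..
  \<comment> \<open>The decoration 0 bounds the sum of the shifts, and over the natural numbers this
    forces each of them to vanish.\<close>
  have "(\<Sum>j\<in>occs C. m j) \<le> 0 \<longleftrightarrow> (\<forall>j\<in>occs C. m j = 0)" for m :: "_ \<Rightarrow> (nat, 'i) vec"
    by (auto simp: less_eq_vec_def vec_eq_iff)
  then have shifts: "shifts C ?\<zeta> ?v = {?m}"
    unfolding shifts_def
    by (auto simp: load less_eq_vec_def PiE_iff extensional_def fun_eq_iff)
  have slots: "{q \<in> slots k. ?w q = []} = slots k" by auto
  have "raised k ?w [] = (\<Sum>q\<in>slots k. axis (fst q) 1)"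
    unfolding raised_def slots ..
  also have "\<dots> = (\<Sum>r\<in>UNIV. \<Sum>j<k $ r. axis r 1)"
    by (simp add: slots_def sum.Sigma split_def del: sum_constant)
  also have "\<dots> = k"
  proof (rule iffD2[OF vec_eq_iff], rule allI)
    fix i
    have "(\<Sum>j<k $ r. (axis r 1 :: (nat, 'i) vec) $ i) = (if r = i then k $ i else 0)" for r
      by (auto simp: axis_nth_nat)
    then show "(\<Sum>r\<in>UNIV. \<Sum>j<k $ r. axis r 1) $ i = k $ i"
      by (simp only: sum_component) simp
  qed
  finally have raised: "raised k ?w [] = k" .
  have PiE: "I \<rightarrow>\<^sub>E {[] :: ('i, 'n, 'o) occ list} = {\<lambda>x\<in>I. []}" for I :: "'x set"
    by (auto simp: PiE_iff extensional_def fun_eq_iff)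
  have "mfact (0 :: (nat, 'i) vec) = 1" by (simp add: mfact_def)
  then have coeff: "graft_coeff C ?\<zeta> ?v ?m = 1"
    by (simp add: graft_coeff_def load)
  have "grafts C ?v ?m [] = image_mset fst (mset_set (occs C))"
    unfolding grafts_def fibre by (intro image_mset_mset_set_cong) (auto split: prod.split)
  then have grafts: "grafts C ?v ?m [] = C" by (simp add: image_mset_fst_occs)
  have "star_tree (Node k None C) ?\<zeta>
      = graft_coeff C ?\<zeta> ?v ?m *\<^sub>R basis (modify (\<lambda>u. dec_at ?\<zeta> u - load C ?v ?m u + raised k ?w u)
          (grafts C ?v ?m) ?\<zeta>)"
    by (simp add: star_tree_def Let_def PiE shifts)
  also have "\<dots> = basis (Node k l C)"
    unfolding coeff modify.simps by (simp add: load raised grafts)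
  finally show ?thesis by (simp add: star_def)
qed

section \<open>Elementary differentials under the adjoint of a strong preparation map\<close>

theorem proposition5:
  fixes s :: "(nat, 'i::{finite,linorder}) vec"
    and dn :: "'n::finite \<Rightarrow> real"
    and dp :: "'o::finite \<Rightarrow> real"
    and dm :: "'o \<Rightarrow> nat"
    and F :: "'o \<Rightarrow> 'n option \<Rightarrow> nat \<Rightarrow> ('i, 'o) var field"
    and R Radj :: "('i, 'n, 'o) tspace \<Rightarrow> ('i, 'n, 'o) tspace"
    and k :: "(nat, 'i) vec" and l :: "'n option"
    and bs :: "(('i, 'o) edge \<times> ('i, 'n, 'o) dtree) list"
  assumes "CARD('i) \<ge> 2"
    and "\<And>r. s $ r > 0"
    and "\<And>t. dn t < 0"
    and "\<And>t. dp t > 0"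
    and "\<And>t. dm t \<ge> 1"
    and "\<And>i l c. c < dm i \<Longrightarrow>
      \<exists>V. finite V \<and> V \<subseteq> {(a, c'). c' < dm (fst a)} \<and> smooth_in V (F i l c)"
    and "strong_preparation_map s dn dp R Radj"
    and "c < dm i"
  shows "elem_diff_lin dm F (Radj (basis (Node k l (mset bs)))) i c =
    diff_prod dm k
      (map (\<lambda>(a, \<tau>). (a, elem_diff dm F \<tau> (fst a))) bs)
      (elem_diff_lin dm F (Radj (basis (Node 0 l {#}))) i c)"
proof -
  have "smooth_field (F i l c)" if "c < dm i" for i l c
    using assms(6)[OF that, of l] by (auto intro: smooth_field.smooth)
  then have nonlin: "smooth_nonlinearity dm F (\<lambda>i l c. Abs_sfield (F i l c))"
    by unfold_locales (simp add: Abs_sfield_inverse)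
  then interpret smooth_nonlinearity dm F "\<lambda>i l c. Abs_sfield (F i l c)" .
  let ?E = "lin_ext (\<lambda>\<tau>. elem_field dm F \<tau> i c)" and ?h = "\<lambda>x. elem_field dm F (snd x) (fst (fst x))"
  let ?y = "Radj (basis (Node 0 l {#}))"
  have lin: "elem_diff_lin dm F x i c = apply_sfield (?E x)" for x
    by (simp add: elem_diff_lin_def lin_ext_def fun_eq_iff apply_sfield_sum scaleR_sfield.rep_eq
      apply_elem_field[OF assms(8)])
  have "Radj (basis (Node k l (mset bs))) = basis (Node k None (mset bs)) \<star> ?y"
    using assms(7) unfolding strong_preparation_map_def star_noise[of k "mset bs" l, symmetric] by blast
  then have "elem_diff_lin dm F (Radj (basis (Node k l (mset bs)))) i c
      = apply_sfield (directional dm k (occs (mset bs)) (\<lambda>j. fst (fst j)) (\<lambda>j. ?h (fst j)) (?E ?y))"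
    by (simp add: lin lin_ext_elem_field_star[OF nonlin assms(8)])
  \<comment> \<open>The occurrences carry no order, so the given list \<open>bs\<close> serves as
    well as the listing that \<open>elem_diff\<close> selects by \<open>SOME\<close>.\<close>
  also have "\<dots> = diff_prod dm k (map (\<lambda>x. (fst x, elem_diff dm F (snd x) (fst (fst x)))) bs)
      (apply_sfield (?E ?y))"
    by (rule apply_directional[symmetric]) (simp_all add: image_mset_fst_occs apply_elem_field)
  finally show ?thesis
    by (simp add: lin case_prod_unfold)
qed

end
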